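(* Let $d$ be a positive integer and $n$ a non-negative integer. A nonempty set $\Gamma\subseteq\mathbb{N}_0^d$ is a contractive projection set for $H^{2(n+1)}(\mathbb{T}^d)$ if and only if $E_n(\Gamma)=\Gamma$.
   Context: $\mathbb{T}^d$ is the $d$-dimensional torus with normalized Haar measure $m_d$; $\widehat f(\alpha)=\int_{\mathbb{T}^d} f\,\overline{z^\alpha}\,dm_d$. $\mathbb{N}_0=\{0,1,2,\dots\}$. $H^p(\mathbb{T}^d)$ is the subspace of $L^p(\mathbb{T}^d)$ of functions with $\widehat f(\alpha)=0$ for $\alpha\notin\mathbb{N}_0^d$. For $\Gamma\subseteq\mathbb{N}_0^d$, $P_\Gamma$ is densely defined by $P_\Gamma f(z)=\sum_{\alpha\in\Gamma}\widehat f(\alpha)z^\alpha$, and $\Gamma$ is a contractive projection set for $H^p(\mathbb{T}^d)$ if $P_\Gamma$ extends to a contraction on $H^p(\mathbb{T}^d)$. For nonempty $\Gamma\subseteq\mathbb{N}_0^d$, $\Lambda(\Gamma)$ denotes the coset in $\mathbb{Z}^d$ generated by $\Gamma$ (the smallest coset of a subgroup of $\mathbb{Z}^d$ containing $\Gamma$); every $\lambda\in\Lambda(\Gamma)$ can be written as $\lambda=\gamma+\sum_{\alpha\in\Gamma,\alpha\neq\gamma}m_{\gamma,\alpha}(\alpha-\gamma)$ with $\gamma\in\Gamma$ and integers $m_{\gamma,\alpha}$, finitely many nonzero. The distance $d(\Gamma,\lambda)$ is the infimum, over all such representations (any $\gamma\in\Gamma$), of $\max\big(\sum_{m_{\gamma,\alpha}>0}m_{\gamma,\alpha},\,-\sum_{m_{\gamma,\alpha}<0}m_{\gamma,\alpha}\big)$.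 The $n$-extension of $\Gamma$ is $E_n(\Gamma)=\{\lambda\in\Lambda(\Gamma)\cap\mathbb{N}_0^d: d(\Gamma,\lambda)\leq n\}$. *)

theory Defs
  imports "HOL-Analysis.Analysis" "HOL-Library.Extended_Nat" "HOL-Library.Function_Algebras"
begin

text \<open>Multi-indices are integer vectors indexed by a finite type 'd (so d = CARD('d) \<ge> 1).
  Points of the torus T^d are maps 'd \<Rightarrow> complex with unimodular entries.\<close>

definition N0 :: "('d \<Rightarrow> int) set" where
  "N0 = {\<alpha>. \<forall>i. 0 \<le> \<alpha> i}"

definition torus :: "('d::finite \<Rightarrow> complex) measure" where
  "torus = distr (PiM UNIV (\<lambda>_. uniform_measure lborel {0..2*pi}))
                 (PiM UNIV (\<lambda>_. borel)) (\<lambda>\<theta> i. cis (\<theta> i))"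

definition mono :: "('d::finite \<Rightarrow> complex) \<Rightarrow> ('d \<Rightarrow> int) \<Rightarrow> complex" where
  "mono z \<alpha> = (\<Prod>i\<in>UNIV. power_int (z i) (\<alpha> i))"

definition fourier :: "(('d::finite \<Rightarrow> complex) \<Rightarrow> complex) \<Rightarrow> ('d \<Rightarrow> int) \<Rightarrow> complex" where
  "fourier f \<alpha> = (\<integral>z. f z * cnj (mono z \<alpha>) \<partial>torus)"

definition Lp_space :: "real \<Rightarrow> (('d::finite \<Rightarrow> complex) \<Rightarrow> complex) set" where
  "Lp_space p = {f. f \<in> borel_measurable torus \<and> integrable torus (\<lambda>z. cmod (f z) powr p)}"

definition Lp_norm :: "real \<Rightarrow> (('d::finite \<Rightarrow> complex) \<Rightarrow> complex) \<Rightarrow> real" where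
  "Lp_norm p f = (\<integral>z. cmod (f z) powr p \<partial>torus) powr (1 / p)"

definition Hardy :: "real \<Rightarrow> (('d::finite \<Rightarrow> complex) \<Rightarrow> complex) set" where
  "Hardy p = {f \<in> Lp_space p. \<forall>\<alpha>. \<alpha> \<notin> N0 \<longrightarrow> fourier f \<alpha> = 0}"

text \<open>Analytic polynomials: the dense domain of P_Gamma.\<close>
definition analytic_polys :: "(('d::finite \<Rightarrow> complex) \<Rightarrow> complex) set" where
  "analytic_polys = {f. \<exists>F c. finite F \<and> F \<subseteq> N0 \<and> f = (\<lambda>z. \<Sum>\<alpha>\<in>F. c \<alpha> * mono z \<alpha>)}"

definition proj :: "('d::finite \<Rightarrow> int) set \<Rightarrow> (('d \<Rightarrow> complex) \<Rightarrow> complex) \<Rightarrow> ('d \<Rightarrow> complex) \<Rightarrow> complex" where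
  "proj \<Gamma> f z = (\<Sum>\<alpha>\<in>{\<alpha>\<in>\<Gamma>. fourier f \<alpha> \<noteq> 0}. fourier f \<alpha> * mono z \<alpha>)"

definition contractive_projection_set :: "real \<Rightarrow> ('d::finite \<Rightarrow> int) set \<Rightarrow> bool" where
  "contractive_projection_set p \<Gamma> \<longleftrightarrow>
     (\<exists>T. (\<forall>f\<in>Hardy p. T f \<in> Hardy p)
        \<and> (\<forall>f\<in>Hardy p. \<forall>g\<in>Hardy p. \<forall>a b::complex.
             AE z in torus. T (\<lambda>w. a * f w + b * g w) z = a * T f z + b * T g z)
        \<and> (\<forall>f\<in>Hardy p. Lp_norm p (T f) \<le> Lp_norm p f)
        \<and> (\<forall>f\<in>analytic_polys. AE z in torus. T f z = proj \<Gamma> f z))"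

definition is_subgroup :: "('d \<Rightarrow> int) set \<Rightarrow> bool" where
  "is_subgroup H \<longleftrightarrow> 0 \<in> H \<and> (\<forall>x\<in>H. \<forall>y\<in>H. x + y \<in> H) \<and> (\<forall>x\<in>H. - x \<in> H)"

definition is_coset :: "('d \<Rightarrow> int) set \<Rightarrow> bool" where
  "is_coset C \<longleftrightarrow> (\<exists>x H. is_subgroup H \<and> C = (\<lambda>h. x + h) ` H)"

definition Lambda :: "('d \<Rightarrow> int) set \<Rightarrow> ('d \<Rightarrow> int) set" where
  "Lambda \<Gamma> = \<Inter> {C. is_coset C \<and> \<Gamma> \<subseteq> C}"

definition is_rep :: "('d \<Rightarrow> int) set \<Rightarrow> ('d \<Rightarrow> int) \<Rightarrow> ('d \<Rightarrow> int) \<Rightarrow> (('d \<Rightarrow> int) \<Rightarrow> int) \<Rightarrow> bool" where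
  "is_rep \<Gamma> l \<gamma> m \<longleftrightarrow> \<gamma> \<in> \<Gamma> \<and> finite {\<alpha>. m \<alpha> \<noteq> 0} \<and> {\<alpha>. m \<alpha> \<noteq> 0} \<subseteq> \<Gamma> - {\<gamma>}
      \<and> l = \<gamma> + (\<Sum>\<alpha>\<in>{\<alpha>. m \<alpha> \<noteq> 0}. (\<lambda>i. m \<alpha> * (\<alpha> i - \<gamma> i)))"

definition rep_cost :: "(('d \<Rightarrow> int) \<Rightarrow> int) \<Rightarrow> nat" where
  "rep_cost m = nat (max (\<Sum>\<alpha>\<in>{\<alpha>. m \<alpha> > 0}. m \<alpha>) (\<Sum>\<alpha>\<in>{\<alpha>. m \<alpha> < 0}. - m \<alpha>))"

definition dist_G :: "('d \<Rightarrow> int) set \<Rightarrow> ('d \<Rightarrow> int) \<Rightarrow> enat" where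
  "dist_G \<Gamma> l = (INF p \<in> {(\<gamma>, m). is_rep \<Gamma> l \<gamma> m}. enat (rep_cost (snd p)))"

definition extension :: "nat \<Rightarrow> ('d \<Rightarrow> int) set \<Rightarrow> ('d \<Rightarrow> int) set" where
  "extension n \<Gamma> = {l \<in> Lambda \<Gamma> \<inter> N0. dist_G \<Gamma> l \<le> enat n}"

end

theory Submission
  imports "HOL-Probability.Infinite_Product_Measure" Defs
begin

text \<open>
  Put \<open>p = 2(n + 1)\<close>. Collecting terms, \<open>extension n \<Gamma>\<close> consists of the \<open>\<eta>\<close> in \<open>N0\<close> that are a sum of
  \<open>n + 1\<close> elements of \<open>\<Gamma>\<close> minus a sum of \<open>n\<close> elements, that is, of the frequencies in \<open>N0\<close> which occur in
  \<open>|h|\<^sup>2\<^sup>n h\<close> for polynomials \<open>h\<close> with frequencies in \<open>\<Gamma>\<close>. Since \<open>|h|\<^sup>2\<^sup>n h\<close> is the gradient of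
  the convex function \<open>|h|\<^sup>p / p\<close>, the \<open>p\<close>-norm of \<open>h\<close> cannot decrease when frequencies outside \<open>\<Gamma>\<close> are added if and
  only if none of them occurs in such a gradient; positive coefficients rule out cancellation in the
  necessity part. To pass from polynomials to \<open>f\<close> in the Hardy space, project the Fejer means of \<open>f\<close>:
  the projections converge in mean square and have \<open>p\<close>-norms bounded by that of \<open>f\<close>, so Fatou's lemma
  bounds the limit.
\<close>

section \<open>The torus and its characters\<close>

text \<open>The even exponent makes the gradient of the power a polynomial in \<open>h\<close> and
  \<open>cnj h\<close>; this is what reduces contractivity to a question about finite sumsets. The
  convexity argument integrates against finitely many frequencies, but a contraction is demanded on
  the whole Hardy space. Cutting \<open>f\<close> off sharply at a box of frequencies need not
  decrease the norm: for \<open>n \<ge> 1\<close> and side at least 1 the box is itself not its own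
  extension, since it omits the double of a corner. Fejer means instead average \<open>f\<close>
  against a probability density, so Jensen's inequality bounds them by \<open>f\<close>. Since
  \<open>p \<ge> 2\<close> and \<open>torus\<close> has mass 1, every \<open>f\<close> in the Hardy
  space is square integrable. The limit of the projected means is therefore taken in mean square,
  where Bessel's inequality controls all tails. Convexity enters through a tangent inequality valid
  for all pairs of points. For sufficiency it is used at the projected polynomial; for necessity at
  the perturbed polynomial, with the perturbation sent to 0 afterwards.\<close>

definition unimodular :: "('d \<Rightarrow> complex) set" where
  "unimodular = {z. \<forall>i. cmod (z i) = 1}"

abbreviation circle_angle :: "real measure" where
  "circle_angle \<equiv> uniform_measure lborel {0..2*pi}"

lemma prob_space_circle_angle: "prob_space circle_angle"
  by (rule prob_space_uniform_measure) auto

lemma measurable_cis: "(\<lambda>\<theta>. cis (a * \<theta>)) \<in> borel_measurable borel"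
  by (simp add: cis_conv_exp)

lemma measurable_cis_vector [measurable]:
  "(\<lambda>\<theta> i. cis (\<theta> i)) \<in> measurable (PiM UNIV (\<lambda>_::'d::finite. circle_angle)) (PiM UNIV (\<lambda>_. borel))"
  by (rule measurable_PiM_single') (auto simp: cis_conv_exp)

lemma sets_torus [measurable_cong, simp]:
  "sets (torus :: ('d::finite \<Rightarrow> complex) measure) = sets (PiM UNIV (\<lambda>_. borel))"
  by (simp add: torus_def)

lemma space_torus [simp]: "space (torus :: ('d::finite \<Rightarrow> complex) measure) = UNIV"
  by (simp add: torus_def space_PiM)

lemma prob_space_torus: "prob_space (torus :: ('d::finite \<Rightarrow> complex) measure)"
proof -
  interpret prob_space "PiM UNIV (\<lambda>_::'d. circle_angle)"
    by (rule prob_space_PiM) (rule prob_space_circle_angle)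
  show ?thesis
    unfolding torus_def by (rule prob_space_distr) (rule measurable_cis_vector)
qed

interpretation torus: prob_space "torus :: ('d::finite \<Rightarrow> complex) measure"
  by (rule prob_space_torus)

lemma measurable_coordinate [measurable]:
  "(\<lambda>z. z i) \<in> borel_measurable (torus :: ('d::finite \<Rightarrow> complex) measure)"
proof -
  have "(\<lambda>z. z i) \<in> measurable (PiM UNIV (\<lambda>_::'d. borel)) (borel :: complex measure)"
    by (rule measurable_component_singleton) simp
  then show ?thesis
    by (simp cong: measurable_cong_sets)
qed

text \<open>The measure lives on all maps into the complex plane, whereas identities such as
  \<open>cnj_mono\<close> may fail off the unit circle. Later integral comparisons are therefore
  made pointwise on \<open>unimodular\<close> and transferred by this fact.\<close>

lemma AE_unimodular: "AE z in torus. z \<in> unimodular"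
  unfolding torus_def
  by (subst AE_distr_iff) (auto simp: unimodular_def)

lemma measurable_mono [measurable]: "(\<lambda>z. mono z \<alpha>) \<in> borel_measurable torus"
  unfolding mono_def power_int_def by measurable

lemma unimodular_nonzero: "z \<in> unimodular \<Longrightarrow> z i \<noteq> 0"
  by (metis (mono_tags, lifting) mem_Collect_eq norm_zero unimodular_def zero_neq_one)

lemma mono_add: "z \<in> unimodular \<Longrightarrow> mono z (\<alpha> + \<beta>) = mono z \<alpha> * mono z \<beta>"
  unfolding mono_def prod.distrib [symmetric]
  by (rule prod.cong) (auto simp: power_int_add unimodular_nonzero)

lemma cnj_mono: "z \<in> unimodular \<Longrightarrow> cnj (mono z \<alpha>) = mono z (- \<alpha>)"
proof -
  assume z: "z \<in> unimodular"
  have "cnj (z i) = inverse (z i)" for i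
    using z inverse_unique [of "z i" "cnj (z i)"] complex_norm_square [of "z i"]
    by (simp add: unimodular_def)
  then show ?thesis
    by (simp add: mono_def power_int_minus power_int_inverse)
qed

lemma mono_diff: "z \<in> unimodular \<Longrightarrow> mono z (\<alpha> - \<beta>) = mono z \<alpha> * cnj (mono z \<beta>)"
  using mono_add [of z \<alpha> "- \<beta>"] by (simp add: cnj_mono)

lemma norm_mono: "z \<in> unimodular \<Longrightarrow> cmod (mono z \<alpha>) = 1"
  by (simp add: mono_def unimodular_def norm_power_int flip: prod_norm)

lemma integral_cis_powi: "(\<integral>\<theta>. cis \<theta> powi k \<partial>circle_angle) = (if k = 0 then 1 else 0)"
proof -
  have emeasure: "emeasure lborel {0..2*pi} = ennreal (2*pi)"
    by simp
  have density: "circle_angle = density lborel (\<lambda>x. ennreal (indicator {0..2*pi} x / (2*pi)))"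
    unfolding uniform_measure_def emeasure
    by (rule density_cong) (auto simp: divide_ennreal [symmetric] split: split_indicator)
  have "(\<integral>\<theta>. cis \<theta> powi k \<partial>circle_angle)
      = (\<integral>\<theta>. (indicator {0..2*pi} \<theta> / (2*pi)) *\<^sub>R (cis \<theta> powi k) \<partial>lborel)"
    unfolding density by (rule integral_density) (auto simp: cis_power_int measurable_cis)
  also have "\<dots> = (\<integral>\<theta>. indicator {0..2*pi} \<theta> *\<^sub>R (cis (of_int k * \<theta>) / (2*pi)) \<partial>lborel)"
    by (rule Bochner_Integration.integral_cong) (auto simp: cis_power_int scaleR_conv_of_real split: split_indicator)
  also have "\<dots> = (if k = 0 then 1 else 0)"
  proof (cases "k = 0")
    case True
    then show ?thesis by (simp add: scaleR_conv_of_real)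
  next
    case False
    define F where "F = (\<lambda>\<theta>::real. cis (of_int k * \<theta>) / (\<i> * of_int k * (2*pi)))"
    have F_of_real: "F = (\<lambda>x. exp (\<i> * of_int k * of_real x) / (\<i> * of_int k * (2*pi)))"
      unfolding F_def cis_conv_exp by (simp add: mult.assoc)
    have "((\<lambda>x. exp (\<i> * of_int k * x) / (\<i> * of_int k * (2*pi))) has_field_derivative
        exp (\<i> * of_int k * of_real x) / (2*pi)) (at (of_real x))" for x :: real
      using False by (auto intro!: derivative_eq_intros)
    from has_vector_derivative_real_field [OF this]
    have "(F has_vector_derivative cis (of_int k * x) / (2*pi)) (at x within {0..2*pi})" for x
      unfolding F_of_real cis_conv_exp by (simp add: mult.assoc)
    then have "(\<integral>\<theta>. indicator {0..2*pi} \<theta> *\<^sub>R (cis (of_int k * \<theta>) / (2*pi)) \<partial>lborel) = F (2*pi) - F 0"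
      by (intro integral_FTC_atLeastAtMost) (auto intro!: continuous_intros simp: cis_conv_exp)
    also have "cis (of_int k * (2*pi)) = 1"
      by (metis cis_multiple_2pi Ints_of_int mult.commute)
    then have "F (2*pi) - F 0 = 0"
      unfolding F_def by simp
    finally show ?thesis using False by simp
  qed
  finally show ?thesis .
qed

text \<open>A character is a product of functions of one angle each, so its integral factorises over
  the coordinates, and a single nonzero exponent makes it vanish.\<close>

lemma integral_monomial:
  "(\<integral>z. mono z \<alpha> \<partial>(torus :: ('d::finite \<Rightarrow> complex) measure)) = (if \<alpha> = 0 then 1 else 0)"
proof -
  interpret prob_space circle_angle
    by (rule prob_space_circle_angle)
  interpret product_sigma_finite "\<lambda>_::'d. circle_angle"
    by unfold_locales
  have "(\<integral>z. mono z \<alpha> \<partial>(torus :: ('d \<Rightarrow> complex) measure))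
      = (\<integral>\<theta>. (\<Prod>i\<in>UNIV. cis (\<theta> i) powi \<alpha> i) \<partial>PiM UNIV (\<lambda>_::'d. circle_angle))"
    unfolding torus_def
    by (subst integral_distr)
       (use measurable_mono[of \<alpha>] in \<open>auto simp: mono_def cong: measurable_cong_sets\<close>)
  also have "\<dots> = (\<Prod>i\<in>UNIV. \<integral>\<theta>. cis \<theta> powi \<alpha> i \<partial>circle_angle)"
    by (rule product_integral_prod)
       (auto intro!: integrable_const_bound [where B = 1] simp: cis_power_int measurable_cis cong: measurable_cong_sets)
  also have "\<dots> = (if \<alpha> = 0 then 1 else 0)"
    by (auto simp: integral_cis_powi fun_eq_iff)
  finally show ?thesis .
qed

section \<open>Extensions as differences of sumsets\<close>

text \<open>Sums with exactly \<open>m\<close> terms, repetitions allowed. The value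
  \<open>{0}\<close> at \<open>m = 0\<close> makes the case \<open>n = 0\<close>, that is exponent
  2, fit the general scheme.\<close>

primrec sumset :: "nat \<Rightarrow> 'a::comm_monoid_add set \<Rightarrow> 'a set" where
  "sumset 0 A = {0}"
| "sumset (Suc m) A = (\<lambda>(x, y). x + y) ` (A \<times> sumset m A)"

lemma sumset_SucI: "x \<in> A \<Longrightarrow> y \<in> sumset m A \<Longrightarrow> x + y \<in> sumset (Suc m) A"
  by auto

lemma finite_sumset: "finite A \<Longrightarrow> finite (sumset m A)"
  by (induction m) auto

lemma sumset_subset: "A \<subseteq> B \<Longrightarrow> sumset m A \<subseteq> sumset m B"
  by (induction m) fastforce+

lemma sumset_add: "x \<in> sumset l A \<Longrightarrow> y \<in> sumset m A \<Longrightarrow> x + y \<in> sumset (l + m) A"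
proof (induction l arbitrary: x)
  case (Suc l)
  then obtain a b where "a \<in> A" "b \<in> sumset l A" "x = a + b"
    by auto
  with Suc sumset_SucI [of a A "b + y" "l + m"] show ?case
    by (simp add: add.assoc)
qed auto

lemma sum_apply: "(\<Sum>a\<in>A. f a) i = (\<Sum>a\<in>A. f a i)"
  by (induction A rule: infinite_finite_induct) auto

lemma multiple_in_sumset:
  fixes \<alpha> :: "'d \<Rightarrow> int"
  assumes "\<alpha> \<in> A"
  shows "(\<lambda>i. int m * \<alpha> i) \<in> sumset m A"
proof (induction m)
  case 0
  then show ?case by (simp add: zero_fun_def)
next
  case (Suc m)
  have "(\<lambda>i. int (Suc m) * \<alpha> i) = \<alpha> + (\<lambda>i. int m * \<alpha> i)"
    by (auto simp: algebra_simps)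
  with sumset_SucI [OF assms Suc] show ?case by simp
qed

lemma weighted_sum_in_sumset:
  fixes A :: "('d \<Rightarrow> int) set" and w :: "('d \<Rightarrow> int) \<Rightarrow> nat"
  assumes "finite W" "W \<subseteq> A"
  shows "(\<lambda>i. \<Sum>\<alpha>\<in>W. int (w \<alpha>) * \<alpha> i) \<in> sumset (\<Sum>\<alpha>\<in>W. w \<alpha>) A"
  using assms
proof (induction W)
  case empty
  then show ?case by (simp add: zero_fun_def)
next
  case (insert x W)
  have "(\<lambda>i. \<Sum>\<alpha>\<in>insert x W. int (w \<alpha>) * \<alpha> i)
      = (\<lambda>i. int (w x) * x i) + (\<lambda>i. \<Sum>\<alpha>\<in>W. int (w \<alpha>) * \<alpha> i)"
    using insert.hyps by auto
  then show ?case
    using insert sumset_add [OF multiple_in_sumset [of x A "w x"]] by simp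
qed

text \<open>The weights count how often each element is used. They vanish off \<open>W\<close>, so
  two such presentations can be subtracted over a common index set in
  \<open>sumset_diff_imp_rep\<close>.\<close>

lemma sumset_weights:
  fixes A :: "('d \<Rightarrow> int) set"
  assumes "a \<in> sumset m A"
  obtains W and w :: "('d \<Rightarrow> int) \<Rightarrow> nat"
  where "finite W" "W \<subseteq> A" "\<And>\<alpha>. \<alpha> \<notin> W \<Longrightarrow> w \<alpha> = 0" "(\<Sum>\<alpha>\<in>W. w \<alpha>) = m"
    "\<And>i. a i = (\<Sum>\<alpha>\<in>W. int (w \<alpha>) * \<alpha> i)"
proof -
  have "\<exists>W w. finite W \<and> W \<subseteq> A \<and> (\<forall>\<alpha>. \<alpha> \<notin> W \<longrightarrow> w \<alpha> = 0) \<and> (\<Sum>\<alpha>\<in>W. w \<alpha>) = m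
      \<and> (\<forall>i. a i = (\<Sum>\<alpha>\<in>W. int (w \<alpha>) * \<alpha> i))"
    using assms
  proof (induction m arbitrary: a)
    case 0
    then show ?case by (intro exI [of _ "{}"] exI [of _ "\<lambda>_. 0"]) auto
  next
    case (Suc m)
    then obtain x b where x: "x \<in> A" "b \<in> sumset m A" "a = x + b"
      by auto
    with Suc.IH obtain W and w :: "('d \<Rightarrow> int) \<Rightarrow> nat" where W: "finite W" "W \<subseteq> A" "\<forall>\<alpha>. \<alpha> \<notin> W \<longrightarrow> w \<alpha> = 0"
      "(\<Sum>\<alpha>\<in>W. w \<alpha>) = m" "\<forall>i. b i = (\<Sum>\<alpha>\<in>W. int (w \<alpha>) * \<alpha> i)"
      by blast
    define w' where "w' = w(x := Suc (w x))"
    \<comment> \<open>If \<open>x\<close> is new then \<open>w x = 0\<close>, so enlarging the index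
      set adds nothing. The abstract \<open>f\<close> serves both the count and the coordinate
      sums.\<close>
    have sum_W: "(\<Sum>\<alpha>\<in>insert x W. f (w \<alpha>) \<alpha>) = (\<Sum>\<alpha>\<in>W. f (w \<alpha>) \<alpha>)" if "f 0 x = 0"
      for f :: "nat \<Rightarrow> ('d \<Rightarrow> int) \<Rightarrow> 'c::comm_monoid_add"
      using that W by (cases "x \<in> W") (auto simp: insert_absorb)
    have "(\<Sum>\<alpha>\<in>insert x W. w' \<alpha>) = (\<Sum>\<alpha>\<in>insert x W. w \<alpha> + (if \<alpha> = x then 1 else 0))"
      by (rule sum.cong) (auto simp: w'_def)
    also have "\<dots> = Suc m"
      using W sum_W [of "\<lambda>k _. k"] by (simp add: sum.distrib del: sum.insert_if)
    finally have 1: "(\<Sum>\<alpha>\<in>insert x W. w' \<alpha>) = Suc m" .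
    have "a i = (\<Sum>\<alpha>\<in>insert x W. int (w' \<alpha>) * \<alpha> i)" for i
    proof -
      have "(\<Sum>\<alpha>\<in>insert x W. int (w' \<alpha>) * \<alpha> i)
          = (\<Sum>\<alpha>\<in>insert x W. int (w \<alpha>) * \<alpha> i + (if \<alpha> = x then x i else 0))"
        by (rule sum.cong) (auto simp: w'_def algebra_simps)
      also have "\<dots> = a i"
        using W x sum_W [of "\<lambda>k \<alpha>. int k * \<alpha> i"] by (simp add: sum.distrib del: sum.insert_if)
      finally show ?thesis by simp
    qed
    with 1 W x show ?case
      by (intro exI [of _ "insert x W"] exI [of _ w']) (auto simp: w'_def)
  qed
  with that show ?thesis by blast
qed

lemma sumset_finite_subset:
  fixes A :: "('d \<Rightarrow> int) set"
  assumes "a \<in> sumset m A"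
  obtains F where "finite F" "F \<subseteq> A" "a \<in> sumset m F"
proof -
  obtain W w where "finite W" "W \<subseteq> A" "(\<Sum>\<alpha>\<in>W. w \<alpha>) = m" "\<And>i. a i = (\<Sum>\<alpha>\<in>W. int (w \<alpha>) * \<alpha> i)"
    using sumset_weights [OF assms] by blast
  moreover from this(4) have "a = (\<lambda>i. \<Sum>\<alpha>\<in>W. int (w \<alpha>) * \<alpha> i)"
    by (rule ext)
  ultimately show ?thesis
    using weighted_sum_in_sumset [of W W w] that [of W] by simp
qed

text \<open>Both sums have the same number of terms, so the terms can be paired off into differences
  lying in \<open>H\<close>.\<close>

lemma sumset_diff_in_subgroup:
  assumes H: "is_subgroup H" and diff: "\<And>x y. x \<in> A \<Longrightarrow> y \<in> A \<Longrightarrow> x - y \<in> H"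
    and "a \<in> sumset m A" "b \<in> sumset m A"
  shows "a - b \<in> H"
  using assms(3,4)
proof (induction m arbitrary: a b)
  case 0
  with H show ?case by (simp add: is_subgroup_def zero_fun_def)
next
  case (Suc m)
  then obtain x a' y b' where *: "x \<in> A" "y \<in> A" "a' \<in> sumset m A" "b' \<in> sumset m A" "a = x + a'" "b = y + b'"
    by auto
  have "a - b = (x - y) + (a' - b')"
    unfolding * by (simp add: algebra_simps)
  moreover have "x - y \<in> H" "a' - b' \<in> H"
    using diff Suc.IH * by blast+
  ultimately show ?case
    using H unfolding is_subgroup_def by metis
qed

text \<open>In any coset containing \<open>A\<close>, the one surplus summand fixes the position in
  the coset; the remaining equally long sums differ by an element of the subgroup.\<close>

lemma sumset_diff_in_Lambda:
  assumes "a \<in> sumset (Suc m) A" "b \<in> sumset m A"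
  shows "a - b \<in> Lambda A"
  unfolding Lambda_def
proof (intro InterI, clarsimp simp: is_coset_def)
  fix x :: "'a \<Rightarrow> int" and H
  assume H: "is_subgroup H" and A: "A \<subseteq> (+) x ` H"
  obtain \<gamma> c where c: "\<gamma> \<in> A" "c \<in> sumset m A" "a = \<gamma> + c"
    using assms(1) by auto
  from A c obtain h where h: "h \<in> H" "\<gamma> = x + h"
    by auto
  have "u - v \<in> H" if "u \<in> A" "v \<in> A" for u v
  proof -
    from that A obtain s t where "s \<in> H" "t \<in> H" "u = x + s" "v = x + t"
      by blast
    moreover from this H have "s + - t \<in> H"
      unfolding is_subgroup_def by blast
    ultimately show ?thesis
      by simp
  qed
  with H c assms(2) have "c - b \<in> H"
    using sumset_diff_in_subgroup by blast
  with H h have "h + (c - b) \<in> H"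
    by (simp add: is_subgroup_def)
  moreover have "a - b = x + (h + (c - b))"
    by (simp add: c h algebra_simps)
  ultimately show "a - b \<in> (+) x ` H"
    by blast
qed

lemma dist_G_le_iff: "dist_G A l \<le> enat n \<longleftrightarrow> (\<exists>\<gamma> m. is_rep A l \<gamma> m \<and> rep_cost m \<le> n)"
proof
  assume le: "dist_G A l \<le> enat n"
  \<comment> \<open>A strict bound on an infimum yields an element below it, and
    \<open>Suc n\<close> turns that back into cost at most \<open>n\<close>. Without representations
    the infimum is infinite, so the bound also excludes that case.\<close>
  have "dist_G A l < enat (Suc n)"
    using le by (metis enat_ord_simps(2) lessI order_le_less_trans)
  then show "\<exists>\<gamma> m. is_rep A l \<gamma> m \<and> rep_cost m \<le> n"
    unfolding dist_G_def by (subst (asm) INF_less_iff) (auto simp: less_Suc_eq_le)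
next
  assume "\<exists>\<gamma> m. is_rep A l \<gamma> m \<and> rep_cost m \<le> n"
  then obtain \<gamma> m where "is_rep A l \<gamma> m" "rep_cost m \<le> n"
    by blast
  then show "dist_G A l \<le> enat n"
    unfolding dist_G_def by (intro INF_lower2 [of "(\<gamma>, m)"]) auto
qed

text \<open>Padding with copies of the base point \<open>\<gamma>\<close> turns both the positive and the negative part of a
  representation of cost at most \<open>n\<close> into a sum of exactly \<open>n\<close> elements.\<close>

lemma rep_imp_sumset_diff:
  assumes "is_rep A l \<gamma> m" "rep_cost m \<le> n"
  shows "\<exists>a \<in> sumset n A. \<exists>b \<in> sumset n A. l = \<gamma> + a - b"
proof -
  define S where "S = {\<alpha>. m \<alpha> \<noteq> 0}"
  have S: "\<gamma> \<in> A" "finite S" "S \<subseteq> A - {\<gamma>}" "\<And>i. l i = \<gamma> i + (\<Sum>\<alpha>\<in>S. m \<alpha> * (\<alpha> i - \<gamma> i))"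
    using assms(1) by (auto simp: is_rep_def S_def sum_apply)
  \<comment> \<open>\<open>nat\<close> truncates at 0, so \<open>P\<close> and \<open>N\<close> are
    the two sums whose maximum is the cost.\<close>
  define P where "P = (\<Sum>\<alpha>\<in>S. nat (m \<alpha>))"
  define N where "N = (\<Sum>\<alpha>\<in>S. nat (- m \<alpha>))"
  have "int P = (\<Sum>\<alpha>\<in>{\<alpha>. m \<alpha> > 0}. m \<alpha>)"
    unfolding P_def of_nat_sum using S(2)
    by (intro sum.mono_neutral_cong_right) (auto simp: S_def)
  moreover have "int N = (\<Sum>\<alpha>\<in>{\<alpha>. m \<alpha> < 0}. - m \<alpha>)"
    unfolding N_def of_nat_sum using S(2)
    by (intro sum.mono_neutral_cong_right) (auto simp: S_def)
  ultimately have "P \<le> n" "N \<le> n"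
    using assms(2) by (auto simp: rep_cost_def)
  define part where "part = (\<lambda>w :: ('a \<Rightarrow> int) \<Rightarrow> nat.
    (\<lambda>i. \<Sum>\<alpha>\<in>S. int (w \<alpha>) * \<alpha> i) + (\<lambda>i. int (n - (\<Sum>\<alpha>\<in>S. w \<alpha>)) * \<gamma> i))"
  have part: "part w \<in> sumset n A" if "(\<Sum>\<alpha>\<in>S. w \<alpha>) \<le> n" for w
    using sumset_add [OF weighted_sum_in_sumset [of S A w] multiple_in_sumset [OF S(1), of "n - (\<Sum>\<alpha>\<in>S. w \<alpha>)"]]
      that S by (auto simp: part_def)
  \<comment> \<open>After padding the total weight is \<open>n\<close>. Written relative to
    \<open>\<gamma>\<close>, every part thus carries the same contribution
    \<open>n * \<gamma>\<close>, which cancels in the difference of two parts.\<close>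
  have part_i: "part w i = (\<Sum>\<alpha>\<in>S. int (w \<alpha>) * (\<alpha> i - \<gamma> i)) + int n * \<gamma> i" if "(\<Sum>\<alpha>\<in>S. w \<alpha>) \<le> n" for w i
    using that by (simp add: part_def of_nat_diff right_diff_distrib left_diff_distrib sum_subtractf
        sum_distrib_right [symmetric] flip: of_nat_sum)
  have "l = \<gamma> + part (\<lambda>\<alpha>. nat (m \<alpha>)) - part (\<lambda>\<alpha>. nat (- m \<alpha>))"
  proof
    fix i
    have "part (\<lambda>\<alpha>. nat (m \<alpha>)) i - part (\<lambda>\<alpha>. nat (- m \<alpha>)) i
        = (\<Sum>\<alpha>\<in>S. int (nat (m \<alpha>)) * (\<alpha> i - \<gamma> i) - int (nat (- m \<alpha>)) * (\<alpha> i - \<gamma> i))"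
      using \<open>P \<le> n\<close> \<open>N \<le> n\<close> by (simp add: part_i P_def N_def sum_subtractf)
    also have "\<dots> = (\<Sum>\<alpha>\<in>S. m \<alpha> * (\<alpha> i - \<gamma> i))"
      by (rule sum.cong) (simp_all add: left_diff_distrib [symmetric])
    finally show "l i = (\<gamma> + part (\<lambda>\<alpha>. nat (m \<alpha>)) - part (\<lambda>\<alpha>. nat (- m \<alpha>))) i"
      by (simp add: S(4))
  qed
  then show ?thesis
    using part \<open>P \<le> n\<close> \<open>N \<le> n\<close> unfolding P_def N_def by blast
qed

text \<open>Take the difference of the two weight functions as coefficients. The equal totals make
  the multiples of \<open>\<gamma>\<close> cancel, the coefficient at \<open>\<gamma>\<close> may be
  set to 0 because it multiplies \<open>\<gamma> - \<gamma>\<close>, and cancellation between the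
  weights can only lower the cost.\<close>

lemma sumset_diff_imp_rep:
  assumes "\<gamma> \<in> A" "a \<in> sumset n A" "b \<in> sumset n A"
  shows "\<exists>m. is_rep A (\<gamma> + a - b) \<gamma> m \<and> rep_cost m \<le> n"
proof -
  obtain V v where V: "finite V" "V \<subseteq> A" "\<And>\<alpha>. \<alpha> \<notin> V \<Longrightarrow> v \<alpha> = 0" "(\<Sum>\<alpha>\<in>V. v \<alpha>) = n"
    "\<And>i. a i = (\<Sum>\<alpha>\<in>V. int (v \<alpha>) * \<alpha> i)"
    using sumset_weights [OF assms(2)] by blast
  obtain W w where W: "finite W" "W \<subseteq> A" "\<And>\<alpha>. \<alpha> \<notin> W \<Longrightarrow> w \<alpha> = 0" "(\<Sum>\<alpha>\<in>W. w \<alpha>) = n"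
    "\<And>i. b i = (\<Sum>\<alpha>\<in>W. int (w \<alpha>) * \<alpha> i)"
    using sumset_weights [OF assms(3)] by blast
  define S where "S = V \<union> W"
  define m where "m = (\<lambda>\<alpha>. if \<alpha> = \<gamma> then 0 else int (v \<alpha>) - int (w \<alpha>))"
  have S: "finite S" "S \<subseteq> A"
    using V W by (auto simp: S_def)
  have m_S: "{\<alpha>. m \<alpha> \<noteq> 0} \<subseteq> S - {\<gamma>}"
  proof
    fix \<alpha> assume "\<alpha> \<in> {\<alpha>. m \<alpha> \<noteq> 0}"
    with V(3) [of \<alpha>] W(3) [of \<alpha>] show "\<alpha> \<in> S - {\<gamma>}"
      by (cases "\<alpha> \<in> V"; cases "\<alpha> \<in> W") (auto simp: m_def S_def split: if_splits)
  qed
  have sum_V: "(\<Sum>\<alpha>\<in>S. int (v \<alpha>) * f \<alpha>) = (\<Sum>\<alpha>\<in>V. int (v \<alpha>) * f \<alpha>)" for f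
    using S V by (intro sum.mono_neutral_right) (auto simp: S_def)
  have sum_W: "(\<Sum>\<alpha>\<in>S. int (w \<alpha>) * f \<alpha>) = (\<Sum>\<alpha>\<in>W. int (w \<alpha>) * f \<alpha>)" for f
    using S W by (intro sum.mono_neutral_right) (auto simp: S_def)
  have v_n: "(\<Sum>\<alpha>\<in>S. int (v \<alpha>)) = int n" and w_n: "(\<Sum>\<alpha>\<in>S. int (w \<alpha>)) = int n"
    using sum_V [of "\<lambda>_. 1"] sum_W [of "\<lambda>_. 1"] V(4) W(4) by (simp_all flip: of_nat_sum)
  have "\<gamma> i + a i - b i = \<gamma> i + (\<Sum>\<alpha>\<in>{\<alpha>. m \<alpha> \<noteq> 0}. m \<alpha> * (\<alpha> i - \<gamma> i))" for i
  proof -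
    have "(\<Sum>\<alpha>\<in>{\<alpha>. m \<alpha> \<noteq> 0}. m \<alpha> * (\<alpha> i - \<gamma> i)) = (\<Sum>\<alpha>\<in>S. m \<alpha> * (\<alpha> i - \<gamma> i))"
      using S m_S by (intro sum.mono_neutral_left) auto
    also have "\<dots> = (\<Sum>\<alpha>\<in>S. (int (v \<alpha>) - int (w \<alpha>)) * (\<alpha> i - \<gamma> i))"
      by (rule sum.cong) (auto simp: m_def)
    also have "\<dots> = (\<Sum>\<alpha>\<in>S. int (v \<alpha>) * \<alpha> i) - (\<Sum>\<alpha>\<in>S. int (w \<alpha>) * \<alpha> i)
        - ((\<Sum>\<alpha>\<in>S. int (v \<alpha>)) - (\<Sum>\<alpha>\<in>S. int (w \<alpha>))) * \<gamma> i"
      by (simp add: algebra_simps sum_subtractf sum.distrib sum_distrib_left)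
    also have "\<dots> = a i - b i"
      by (simp add: V(5) W(5) sum_V sum_W v_n w_n)
    finally show ?thesis by simp
  qed
  then have "is_rep A (\<gamma> + a - b) \<gamma> m"
    unfolding is_rep_def using assms(1) S m_S by (auto simp: sum_apply fun_eq_iff intro: finite_subset)
  moreover have "rep_cost m \<le> n"
  proof -
    have "(\<Sum>\<alpha>\<in>{\<alpha>. m \<alpha> > 0}. m \<alpha>) \<le> (\<Sum>\<alpha>\<in>{\<alpha>. m \<alpha> > 0}. int (v \<alpha>))"
      by (rule sum_mono) (auto simp: m_def split: if_splits)
    also have "\<dots> \<le> int n"
      unfolding v_n [symmetric] using S subsetD [OF m_S] by (intro sum_mono2) auto
    finally have 1: "(\<Sum>\<alpha>\<in>{\<alpha>. m \<alpha> > 0}. m \<alpha>) \<le> int n" .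
    have "(\<Sum>\<alpha>\<in>{\<alpha>. m \<alpha> < 0}. - m \<alpha>) \<le> (\<Sum>\<alpha>\<in>{\<alpha>. m \<alpha> < 0}. int (w \<alpha>))"
      by (rule sum_mono) (auto simp: m_def split: if_splits)
    also have "\<dots> \<le> int n"
      unfolding w_n [symmetric] using S subsetD [OF m_S] by (intro sum_mono2) auto
    finally have 2: "(\<Sum>\<alpha>\<in>{\<alpha>. m \<alpha> < 0}. - m \<alpha>) \<le> int n" .
    from 1 2 show ?thesis
      by (simp add: rep_cost_def)
  qed
  ultimately show ?thesis by blast
qed

text \<open>One of the \<open>n + 1\<close> summands acts as the base point of a representation; the
  other \<open>n\<close> and the \<open>n\<close> subtracted ones give its positive and negative
  parts. The coset condition comes from \<open>sumset_diff_in_Lambda\<close>.\<close>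

theorem extension_eq_sumset:
  "extension n A = {l \<in> N0. \<exists>a \<in> sumset (Suc n) A. \<exists>b \<in> sumset n A. l = a - b}"
proof (intro set_eqI iffI)
  fix l
  assume "l \<in> extension n A"
  then obtain \<gamma> m where l: "l \<in> N0" "is_rep A l \<gamma> m" "rep_cost m \<le> n"
    by (auto simp: extension_def dist_G_le_iff)
  then obtain a b where "a \<in> sumset n A" "b \<in> sumset n A" "l = \<gamma> + a - b"
    using rep_imp_sumset_diff by blast
  moreover have "\<gamma> \<in> A"
    using l by (simp add: is_rep_def)
  ultimately show "l \<in> {l \<in> N0. \<exists>a \<in> sumset (Suc n) A. \<exists>b \<in> sumset n A. l = a - b}"
    using l sumset_SucI by blast
next
  fix l
  assume "l \<in> {l \<in> N0. \<exists>a \<in> sumset (Suc n) A. \<exists>b \<in> sumset n A. l = a - b}"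
  then obtain a b where l: "l \<in> N0" "a \<in> sumset (Suc n) A" "b \<in> sumset n A" "l = a - b"
    by blast
  then obtain \<gamma> c where "\<gamma> \<in> A" "c \<in> sumset n A" "a = \<gamma> + c"
    by auto
  with l sumset_diff_imp_rep [of \<gamma> A c n b] sumset_diff_in_Lambda [of a n A b]
  show "l \<in> extension n A"
    unfolding extension_def dist_G_le_iff by blast
qed

section \<open>Trigonometric polynomials\<close>

lemma measurable_cnj [measurable]: "cnj \<in> borel_measurable borel"
  by (intro borel_measurable_continuous_onI continuous_intros)

lemma torus_integrable_bounded:
  fixes f :: "('d::finite \<Rightarrow> complex) \<Rightarrow> 'b::{banach, second_countable_topology}"
  assumes "f \<in> borel_measurable torus" "\<And>z. z \<in> unimodular \<Longrightarrow> norm (f z) \<le> B"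
  shows "integrable torus f"
  using AE_unimodular by (intro torus.integrable_const_bound [of _ B] assms(1)) (auto simp: assms(2))

lemma torus_integral_cong:
  fixes f g :: "('d::finite \<Rightarrow> complex) \<Rightarrow> 'b::{banach, second_countable_topology}"
  assumes "f \<in> borel_measurable torus" "g \<in> borel_measurable torus"
    "\<And>z. z \<in> unimodular \<Longrightarrow> f z = g z"
  shows "integral\<^sup>L torus f = integral\<^sup>L torus g"
  using AE_unimodular assms by (intro integral_cong_AE) (auto elim: AE_mp)

lemma torus_integral_mono:
  fixes f g :: "('d::finite \<Rightarrow> complex) \<Rightarrow> real"
  assumes "integrable torus f" "integrable torus g" "\<And>z. z \<in> unimodular \<Longrightarrow> f z \<le> g z"
  shows "integral\<^sup>L torus f \<le> integral\<^sup>L torus g"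
  using AE_unimodular assms by (intro integral_mono_AE) (auto elim: AE_mp)

definition trig_poly :: "('d::finite \<Rightarrow> int) set \<Rightarrow> (('d \<Rightarrow> int) \<Rightarrow> complex) \<Rightarrow> ('d \<Rightarrow> complex) \<Rightarrow> complex" where
  "trig_poly F c z = (\<Sum>\<alpha>\<in>F. c \<alpha> * mono z \<alpha>)"

lemma measurable_trig_poly [measurable]: "trig_poly F c \<in> borel_measurable torus"
  unfolding trig_poly_def by measurable

lemma norm_trig_poly_le: "z \<in> unimodular \<Longrightarrow> cmod (trig_poly F c z) \<le> (\<Sum>\<alpha>\<in>F. cmod (c \<alpha>))"
  unfolding trig_poly_def by (rule sum_norm_le) (simp add: norm_mult norm_mono)

lemma integral_mono_cnj_mono:
  "(\<integral>z. mono z \<alpha> * cnj (mono z \<beta>) \<partial>torus) = (if \<alpha> = \<beta> then 1 else 0)"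
proof -
  have "(\<integral>z. mono z \<alpha> * cnj (mono z \<beta>) \<partial>torus) = (\<integral>z. mono z (\<alpha> - \<beta>) \<partial>torus)"
    by (rule torus_integral_cong) (auto simp: mono_diff)
  also have "\<dots> = (if \<alpha> = \<beta> then 1 else 0)"
    unfolding integral_monomial right_minus_eq by (rule refl)
  finally show ?thesis .
qed

lemma integrable_mono_cnj_mono: "integrable torus (\<lambda>z. mono z \<alpha> * cnj (mono z \<beta>))"
  by (rule torus_integrable_bounded [of _ 1]) (auto simp: norm_mono norm_mult)

lemma fourier_trig_poly:
  assumes "finite F"
  shows "fourier (trig_poly F c) \<alpha> = (if \<alpha> \<in> F then c \<alpha> else 0)"
proof -
  have "fourier (trig_poly F c) \<alpha> = (\<integral>z. (\<Sum>\<beta>\<in>F. c \<beta> * (mono z \<beta> * cnj (mono z \<alpha>))) \<partial>torus)"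
    by (simp add: fourier_def trig_poly_def sum_distrib_right mult.assoc)
  also have "\<dots> = (\<Sum>\<beta>\<in>F. c \<beta> * (if \<beta> = \<alpha> then 1 else 0))"
    by (simp add: integrable_mono_cnj_mono integral_mono_cnj_mono)
  also have "\<dots> = (if \<alpha> \<in> F then c \<alpha> else 0)"
    using assms by (simp add: if_distrib cong: if_cong)
  finally show ?thesis .
qed

lemma proj_trig_poly:
  assumes "finite F"
  shows "proj \<Gamma> (trig_poly F c) = trig_poly (F \<inter> \<Gamma>) c"
  unfolding proj_def trig_poly_def [of "F \<inter> \<Gamma>"] fun_eq_iff fourier_trig_poly [OF assms]
  using assms by (intro allI sum.mono_neutral_cong_left) (auto split: if_splits)

text \<open>Coefficients convolve over the fibres of addition. The index set keeps every sum of
  frequencies, even one whose fibre sum happens to vanish.\<close>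

lemma trig_poly_mult:
  assumes "finite F" "finite G" "z \<in> unimodular"
  shows "trig_poly F c z * trig_poly G d z
    = trig_poly ((\<lambda>(x, y). x + y) ` (F \<times> G))
        (\<lambda>\<gamma>. \<Sum>p \<in> {p \<in> F \<times> G. fst p + snd p = \<gamma>}. c (fst p) * d (snd p)) z"
proof -
  let ?h = "\<lambda>p. c (fst p) * d (snd p) * mono z (fst p + snd p)"
  have img: "(\<lambda>(x, y). x + y) ` (F \<times> G) = (\<lambda>p. fst p + snd p) ` (F \<times> G)"
    by (auto simp: case_prod_unfold)
  have "trig_poly F c z * trig_poly G d z = (\<Sum>p\<in>F \<times> G. ?h p)"
    using assms(3) unfolding trig_poly_def
    by (simp add: sum_product sum.cartesian_product mono_add case_prod_unfold mult_ac)
  also have "\<dots> = (\<Sum>\<gamma>\<in>(\<lambda>p. fst p + snd p) ` (F \<times> G). \<Sum>p \<in> {p \<in> F \<times> G. fst p + snd p = \<gamma>}. ?h p)"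
    using assms by (intro sum.image_gen) auto
  also have "\<dots> = trig_poly ((\<lambda>p. fst p + snd p) ` (F \<times> G))
      (\<lambda>\<gamma>. \<Sum>p \<in> {p \<in> F \<times> G. fst p + snd p = \<gamma>}. c (fst p) * d (snd p)) z"
    unfolding trig_poly_def sum_distrib_right by (intro sum.cong refl) auto
  finally show ?thesis
    unfolding img .
qed

lemma complex_mult_pos: "0 < a \<Longrightarrow> 0 < b \<Longrightarrow> 0 < a * (b :: complex)"
  by (simp add: less_complex_def)

text \<open>In the order on \<open>complex\<close>, \<open>0 < c\<close> means that \<open>c\<close>
  is a positive real. Each fibre over a frequency of the sumset is nonempty, so sums of products of
  positive reals stay positive and no frequency is lost to cancellation.\<close>

lemma trig_poly_power:
  assumes "finite F"
  obtains d where "\<And>z. z \<in> unimodular \<Longrightarrow> trig_poly F c z ^ m = trig_poly (sumset m F) d z"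
    "(\<forall>\<alpha>\<in>F. 0 < c \<alpha>) \<longrightarrow> (\<forall>\<alpha>\<in>sumset m F. 0 < d \<alpha>)"
proof -
  have "\<exists>d. (\<forall>z \<in> unimodular. trig_poly F c z ^ m = trig_poly (sumset m F) d z)
    \<and> ((\<forall>\<alpha>\<in>F. 0 < c \<alpha>) \<longrightarrow> (\<forall>\<alpha>\<in>sumset m F. 0 < d \<alpha>))"
  proof (induction m)
    case 0
    then show ?case
      by (intro exI [of _ "\<lambda>_. 1"]) (simp add: trig_poly_def mono_def less_complex_def)
  next
    case (Suc m)
    then obtain d where d: "\<forall>z \<in> unimodular. trig_poly F c z ^ m = trig_poly (sumset m F) d z"
      "(\<forall>\<alpha>\<in>F. 0 < c \<alpha>) \<longrightarrow> (\<forall>\<alpha>\<in>sumset m F. 0 < d \<alpha>)"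
      by blast
    define e where "e = (\<lambda>\<gamma>. \<Sum>p \<in> {p \<in> F \<times> sumset m F. fst p + snd p = \<gamma>}. c (fst p) * d (snd p))"
    have "trig_poly F c z ^ Suc m = trig_poly (sumset (Suc m) F) e z" if "z \<in> unimodular" for z
      using trig_poly_mult [OF assms finite_sumset [OF assms] that] d(1) that by (simp add: e_def)
    moreover have "0 < e \<gamma>" if "\<forall>\<alpha>\<in>F. 0 < c \<alpha>" "\<gamma> \<in> sumset (Suc m) F" for \<gamma>
      unfolding e_def using that d(2) assms finite_sumset [OF assms]
      by (intro sum_pos) (auto simp: complex_mult_pos)
    ultimately show ?case by blast
  qed
  with that show ?thesis by blast
qed

lemma integral_trig_poly_mult_cnj:
  assumes "finite F" "finite G"
  shows "(\<integral>z. trig_poly F c z * cnj (trig_poly G d z) \<partial>torus) = (\<Sum>\<alpha>\<in>F \<inter> G. c \<alpha> * cnj (d \<alpha>))"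
proof -
  have "(\<integral>z. trig_poly F c z * cnj (trig_poly G d z) \<partial>torus)
      = (\<integral>z. (\<Sum>\<alpha>\<in>F. \<Sum>\<beta>\<in>G. c \<alpha> * cnj (d \<beta>) * (mono z \<alpha> * cnj (mono z \<beta>))) \<partial>torus)"
    by (simp add: trig_poly_def sum_product mult_ac)
  also have "\<dots> = (\<Sum>\<alpha>\<in>F. \<Sum>\<beta>\<in>G. c \<alpha> * cnj (d \<beta>) * (if \<alpha> = \<beta> then 1 else 0))"
    by (simp add: integrable_mono_cnj_mono integral_mono_cnj_mono)
  also have "\<dots> = (\<Sum>\<alpha>\<in>F. if \<alpha> \<in> G then c \<alpha> * cnj (d \<alpha>) else 0)"
    using assms by (simp add: if_distrib cong: if_cong)
  also have "\<dots> = (\<Sum>\<alpha>\<in>F \<inter> G. c \<alpha> * cnj (d \<alpha>))"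
    using assms by (simp add: sum.inter_restrict)
  finally show ?thesis .
qed

lemma integral_norm_trig_poly_squared:
  assumes "finite F"
  shows "(\<integral>z. (cmod (trig_poly F c z))\<^sup>2 \<partial>torus) = (\<Sum>\<alpha>\<in>F. (cmod (c \<alpha>))\<^sup>2)"
proof -
  have "complex_of_real (\<integral>z. (cmod (trig_poly F c z))\<^sup>2 \<partial>torus)
      = (\<integral>z. trig_poly F c z * cnj (trig_poly F c z) \<partial>torus)"
    by (simp add: complex_norm_square [symmetric] integral_complex_of_real [symmetric])
  also have "\<dots> = complex_of_real (\<Sum>\<alpha>\<in>F. (cmod (c \<alpha>))\<^sup>2)"
    unfolding integral_trig_poly_mult_cnj [OF assms assms]
    by (simp only: complex_norm_square [symmetric] of_real_sum Int_absorb)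
  finally show ?thesis
    by (simp only: of_real_eq_iff)
qed

section \<open>Tangent inequalities for even powers of the modulus\<close>

lemma power_tangent_le:
  fixes s t :: real
  assumes "0 \<le> s" "0 \<le> t"
  shows "s ^ Suc m + Suc m * s ^ m * (t - s) \<le> t ^ Suc m"
proof (induction m)
  case (Suc m)
  \<comment> \<open>Multiplying the inequality for \<open>m\<close> by \<open>t\<close> gives the
    tangent line for \<open>Suc m\<close> plus exactly this nonnegative square term.\<close>
  have "s ^ Suc (Suc m) + Suc (Suc m) * s ^ Suc m * (t - s)
      \<le> s ^ Suc (Suc m) + Suc (Suc m) * s ^ Suc m * (t - s) + Suc m * s ^ m * (t - s)\<^sup>2"
    using assms by simp
  also have "\<dots> = t * (s ^ Suc m + Suc m * s ^ m * (t - s))"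
    by (simp add: algebra_simps power2_eq_square)
  also have "\<dots> \<le> t * t ^ Suc m"
    using Suc assms by (intro mult_left_mono) auto
  finally show ?case by simp
qed simp

text \<open>The supporting hyperplane at \<open>b\<close> of the convex function \<open>cmod\<close>
  to the power \<open>2 * Suc n\<close>. Bounding the real part of \<open>cnj b * a\<close> by the
  product of the moduli reduces it to the tangent of a real power.\<close>

lemma norm_power_tangent_le:
  fixes a b :: complex
  shows "cmod b ^ (2 * Suc n) + 2 * Suc n * (cmod b ^ (2 * n) * Re (cnj b * (a - b))) \<le> cmod a ^ (2 * Suc n)"
proof -
  have "Re (cnj b * a) \<le> cmod b * cmod a"
    using complex_Re_le_cmod [of "cnj b * a"] by (simp add: norm_mult)
  moreover have "Re (cnj b * b) = cmod b * cmod b"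
    by (simp add: cmod_power2 flip: power2_eq_square)
  ultimately have "Re (cnj b * (a - b)) \<le> cmod b * (cmod a - cmod b)"
    by (simp add: right_diff_distrib)
  then have "2 * Suc n * (cmod b ^ (2 * n) * Re (cnj b * (a - b)))
      \<le> 2 * Suc n * (cmod b ^ (2 * n) * (cmod b * (cmod a - cmod b)))"
    by (intro mult_left_mono) auto
  then show ?thesis
    using power_tangent_le [of "cmod b" "cmod a" "Suc (2 * n)"] by (simp add: mult_ac)
qed

text \<open>Here the even exponent is used: the gradient is a polynomial in \<open>b\<close> and
  \<open>cnj b\<close>, so for a trigonometric polynomial \<open>b\<close> it has finitely many
  frequencies.\<close>

lemma norm_power_cnj: "complex_of_real (cmod b ^ (2 * n)) * cnj b = b ^ n * cnj (b ^ Suc n)"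
proof -
  have "complex_of_real (cmod b ^ (2 * n)) = (b * cnj b) ^ n"
    by (simp only: power_mult of_real_power [of "(cmod b)\<^sup>2" n] complex_norm_square)
  then show ?thesis
    by (simp add: power_mult_distrib mult_ac)
qed

lemma Re_norm_power_cnj: "cmod b ^ (2 * n) * Re (cnj b * w) = Re (b ^ n * cnj (b ^ Suc n) * w)"
proof -
  have "Re (complex_of_real r * x) = r * Re x" for r x
    by simp
  then show ?thesis
    unfolding norm_power_cnj [symmetric] mult.assoc by (rule sym)
qed

text \<open>The integral pairs \<open>z\<^sup>\<eta>\<close> with \<open>f\<^sup>n\<^sup>+\<^sup>1 cnj f\<^sup>n\<close>, whose frequencies are the differences of sums of
  \<open>n + 1\<close> and \<open>n\<close> frequencies of \<open>f\<close>.\<close>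

lemma gradient_pairing:
  assumes "finite F"
  obtains d e where
    "\<And>\<eta>. (\<integral>z. trig_poly F c z ^ n * cnj (trig_poly F c z ^ Suc n) * mono z \<eta> \<partial>torus)
      = (\<Sum>b \<in> {b \<in> sumset n F. b + \<eta> \<in> sumset (Suc n) F}. d b * cnj (e (b + \<eta>)))"
    "(\<forall>\<alpha>\<in>F. 0 < c \<alpha>) \<longrightarrow> (\<forall>\<alpha>\<in>sumset n F. 0 < d \<alpha>)"
    "(\<forall>\<alpha>\<in>F. 0 < c \<alpha>) \<longrightarrow> (\<forall>\<alpha>\<in>sumset (Suc n) F. 0 < e \<alpha>)"
proof -
  obtain d where d: "\<And>z. z \<in> unimodular \<Longrightarrow> trig_poly F c z ^ n = trig_poly (sumset n F) d z"
    "(\<forall>\<alpha>\<in>F. 0 < c \<alpha>) \<longrightarrow> (\<forall>\<alpha>\<in>sumset n F. 0 < d \<alpha>)"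
    using trig_poly_power [OF assms, of c n] by blast
  obtain e where e: "\<And>z. z \<in> unimodular \<Longrightarrow> trig_poly F c z ^ Suc n = trig_poly (sumset (Suc n) F) e z"
    "(\<forall>\<alpha>\<in>F. 0 < c \<alpha>) \<longrightarrow> (\<forall>\<alpha>\<in>sumset (Suc n) F. 0 < e \<alpha>)"
    using trig_poly_power [OF assms, of c "Suc n"] by blast
  have "(\<integral>z. trig_poly F c z ^ n * cnj (trig_poly F c z ^ Suc n) * mono z \<eta> \<partial>torus)
      = (\<Sum>b \<in> {b \<in> sumset n F. b + \<eta> \<in> sumset (Suc n) F}. d b * cnj (e (b + \<eta>)))" for \<eta>
  proof -
    let ?G = "(\<lambda>b. b + \<eta>) ` sumset n F"
    have inj: "inj_on (\<lambda>b. b + \<eta>) X" for X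
      by (rule inj_onI) (metis add_right_cancel)
    \<comment> \<open>Multiplication by the character \<open>\<eta>\<close> translates frequencies,
      so orthogonality leaves exactly the matches \<open>b + \<eta> = a\<close> between the two
      sumsets.\<close>
    have shift: "trig_poly (sumset n F) d z * mono z \<eta> = trig_poly ?G (\<lambda>a. d (a - \<eta>)) z"
      if "z \<in> unimodular" for z
      unfolding trig_poly_def using that
      by (simp add: sum.reindex [OF inj] sum_distrib_right mono_add mult.assoc del: fun_diff_def)
    have "(\<integral>z. trig_poly F c z ^ n * cnj (trig_poly F c z ^ Suc n) * mono z \<eta> \<partial>torus)
        = (\<integral>z. trig_poly ?G (\<lambda>a. d (a - \<eta>)) z * cnj (trig_poly (sumset (Suc n) F) e z) \<partial>torus)"
    proof (rule torus_integral_cong)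
      fix z :: "'a \<Rightarrow> complex" assume z: "z \<in> unimodular"
      have "trig_poly F c z ^ n * cnj (trig_poly F c z ^ Suc n) * mono z \<eta>
          = (trig_poly (sumset n F) d z * mono z \<eta>) * cnj (trig_poly (sumset (Suc n) F) e z)"
        unfolding d(1) [OF z] e(1) [OF z] by (simp only: mult_ac)
      then show "trig_poly F c z ^ n * cnj (trig_poly F c z ^ Suc n) * mono z \<eta>
          = trig_poly ?G (\<lambda>a. d (a - \<eta>)) z * cnj (trig_poly (sumset (Suc n) F) e z)"
        unfolding shift [OF z] .
    qed measurable
    also have "\<dots> = (\<Sum>a\<in>?G \<inter> sumset (Suc n) F. d (a - \<eta>) * cnj (e a))"
      using assms finite_sumset by (intro integral_trig_poly_mult_cnj) blast+
    also have "?G \<inter> sumset (Suc n) F = (\<lambda>b. b + \<eta>) ` {b \<in> sumset n F. b + \<eta> \<in> sumset (Suc n) F}"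
      by blast
    also have "(\<Sum>a\<in>\<dots>. d (a - \<eta>) * cnj (e a))
        = (\<Sum>b \<in> {b \<in> sumset n F. b + \<eta> \<in> sumset (Suc n) F}. d b * cnj (e (b + \<eta>)))"
      by (subst sum.reindex [OF inj]) (simp only: o_def add_diff_cancel_right')
    finally show ?thesis .
  qed
  then show ?thesis
    by (intro that [of d e] d(2) e(2))
qed

section \<open>Contractivity on polynomials\<close>

lemma trig_poly_union_disjoint:
  assumes "finite F" "finite G" "F \<inter> G = {}"
  shows "trig_poly (F \<union> G) c z = trig_poly F c z + trig_poly G c z"
  unfolding trig_poly_def using assms by (rule sum.union_disjoint)

lemma integrable_norm_trig_poly_power: "integrable torus (\<lambda>z. cmod (trig_poly F c z) ^ m)"
  by (rule torus_integrable_bounded [of _ "(\<Sum>\<alpha>\<in>F. cmod (c \<alpha>)) ^ m"])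
     (auto simp: norm_power intro!: power_mono norm_trig_poly_le)

lemma integrable_gradient_pairing:
  "integrable torus (\<lambda>z. trig_poly F c z ^ n * cnj (trig_poly F c z ^ Suc n) * trig_poly G d z)"
proof (rule torus_integrable_bounded)
  let ?M = "(\<Sum>\<alpha>\<in>F. cmod (c \<alpha>))" and ?N = "(\<Sum>\<alpha>\<in>G. cmod (d \<alpha>))"
  fix z :: "'a \<Rightarrow> complex" assume z: "z \<in> unimodular"
  have "0 \<le> ?M" by (simp add: sum_nonneg)
  then show "norm (trig_poly F c z ^ n * cnj (trig_poly F c z ^ Suc n) * trig_poly G d z) \<le> ?M ^ n * ?M ^ Suc n * ?N"
    unfolding norm_mult complex_mod_cnj norm_power using z
    by (intro mult_mono power_mono norm_trig_poly_le) auto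
qed measurable

text \<open>The tangent inequality is taken at the projected part \<open>?h\<close> in the direction
  of the discarded part \<open>?g\<close>. Its linear term integrates to 0: a frequency of
  \<open>?g\<close> matched in the pairing would be a difference of sumset elements and, lying in
  \<open>N0\<close>, would belong to \<open>extension n \<Gamma>\<close> and hence to
  \<open>\<Gamma>\<close>.\<close>

lemma trig_poly_projection_contractive:
  assumes F: "finite F" "F \<subseteq> N0" and ext: "extension n \<Gamma> \<subseteq> \<Gamma>"
  shows "(\<integral>z. cmod (trig_poly (F \<inter> \<Gamma>) c z) ^ (2 * Suc n) \<partial>torus)
    \<le> (\<integral>z. cmod (trig_poly F c z) ^ (2 * Suc n) \<partial>torus)"
proof -
  let ?h = "trig_poly (F \<inter> \<Gamma>) c" and ?g = "trig_poly (F - \<Gamma>) c"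
  let ?G = "\<lambda>z. ?h z ^ n * cnj (?h z ^ Suc n)"
  have split: "trig_poly F c z = ?h z + ?g z" for z
    using trig_poly_union_disjoint [of "F \<inter> \<Gamma>" "F - \<Gamma>" c z] F by (simp add: Un_Diff_Int Int_Diff_disjoint Un_commute)
  obtain d e where de: "\<And>\<eta>. (\<integral>z. ?G z * mono z \<eta> \<partial>torus)
      = (\<Sum>b \<in> {b \<in> sumset n (F \<inter> \<Gamma>). b + \<eta> \<in> sumset (Suc n) (F \<inter> \<Gamma>)}. d b * cnj (e (b + \<eta>)))"
    by (rule gradient_pairing [of "F \<inter> \<Gamma>" c n]) (use F in blast)+
  have zero: "(\<integral>z. ?G z * mono z \<eta> \<partial>torus) = 0" if \<eta>: "\<eta> \<in> F - \<Gamma>" for \<eta>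
  proof -
    have False if "b \<in> sumset n (F \<inter> \<Gamma>)" "b + \<eta> \<in> sumset (Suc n) (F \<inter> \<Gamma>)" for b
    proof -
      have "b \<in> sumset n \<Gamma>" "b + \<eta> \<in> sumset (Suc n) \<Gamma>"
        using that sumset_subset [of "F \<inter> \<Gamma>" \<Gamma>] by blast+
      moreover have "\<eta> = (b + \<eta>) - b"
        by simp
      ultimately have "\<eta> \<in> extension n \<Gamma>"
        unfolding extension_eq_sumset using \<eta> F by blast
      with ext \<eta> show False by blast
    qed
    then have "{b \<in> sumset n (F \<inter> \<Gamma>). b + \<eta> \<in> sumset (Suc n) (F \<inter> \<Gamma>)} = {}"
      by blast
    then show ?thesis
      unfolding de by (simp only: sum.empty)
  qed
  have int: "integrable torus (\<lambda>z. ?G z * mono z \<eta>)" for \<eta>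
    using integrable_gradient_pairing [of "F \<inter> \<Gamma>" c n "{\<eta>}" "\<lambda>_. 1"] by (simp add: trig_poly_def [of "{\<eta>}"])
  define G where "G = ?G"
  have int_G: "integrable torus (\<lambda>z. G z * mono z \<eta>)" for \<eta>
    unfolding G_def by (rule int)
  have zero_G: "(\<integral>z. G z * mono z \<eta> \<partial>torus) = 0" if "\<eta> \<in> F - \<Gamma>" for \<eta>
    unfolding G_def using that by (rule zero)
  have "(\<integral>z. G z * ?g z \<partial>torus) = (\<integral>z. (\<Sum>\<eta>\<in>F - \<Gamma>. c \<eta> * (G z * mono z \<eta>)) \<partial>torus)"
    by (simp add: trig_poly_def [of "F - \<Gamma>"] sum_distrib_left mult.left_commute)
  also have "\<dots> = (\<Sum>\<eta>\<in>F - \<Gamma>. c \<eta> * (\<integral>z. G z * mono z \<eta> \<partial>torus))"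
    using int_G by simp
  also have "\<dots> = 0"
    using zero_G by simp
  finally have G0: "(\<integral>z. G z * ?g z \<partial>torus) = 0" .
  have G_int: "integrable torus (\<lambda>z. G z * ?g z)"
    unfolding G_def by (rule integrable_gradient_pairing)
  have "(\<integral>z. cmod (?h z) ^ (2 * Suc n) \<partial>torus)
      = (\<integral>z. cmod (?h z) ^ (2 * Suc n) + 2 * Suc n * Re (G z * ?g z) \<partial>torus)"
    using G0 integral_Re [OF G_int] integrable_Re [OF G_int]
    by (subst Bochner_Integration.integral_add) (auto intro: integrable_norm_trig_poly_power simp del: power_Suc mult_Suc_right times_complex.sel)
  also have "\<dots> \<le> (\<integral>z. cmod (trig_poly F c z) ^ (2 * Suc n) \<partial>torus)"
  proof (rule torus_integral_mono)
    fix z :: "'a \<Rightarrow> complex"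
    show "cmod (?h z) ^ (2 * Suc n) + 2 * Suc n * Re (G z * ?g z) \<le> cmod (trig_poly F c z) ^ (2 * Suc n)"
      using norm_power_tangent_le [where a = "trig_poly F c z" and b = "?h z" and n = n]
      unfolding Re_norm_power_cnj split G_def by (simp only: add_diff_cancel_left')
  qed (intro Bochner_Integration.integrable_add integrable_mult_right integrable_norm_trig_poly_power integrable_Re [OF G_int])+
  finally show ?thesis .
qed

text \<open>If \<open>\<eta> \<in> extension n \<Gamma> - \<Gamma>\<close>, then subtracting a small multiple of \<open>z\<^sup>\<eta>\<close> from a polynomial with
  frequencies in \<open>\<Gamma>\<close> and positive coefficients decreases the norm.\<close>

lemma trig_poly_projection_contractive_imp_extension:
  assumes contr: "\<And>F c. finite F \<Longrightarrow> F \<subseteq> N0 \<Longrightarrow>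
      (\<integral>z. cmod (trig_poly (F \<inter> \<Gamma>) c z) ^ (2 * Suc n) \<partial>torus)
      \<le> (\<integral>z. cmod (trig_poly F c z) ^ (2 * Suc n) \<partial>torus)"
    and "\<Gamma> \<subseteq> N0"
  shows "extension n \<Gamma> \<subseteq> \<Gamma>"
proof (rule ccontr)
  assume "\<not> extension n \<Gamma> \<subseteq> \<Gamma>"
  then obtain \<eta> a b where \<eta>: "\<eta> \<in> N0" "\<eta> \<notin> \<Gamma>" "a \<in> sumset (Suc n) \<Gamma>" "b \<in> sumset n \<Gamma>" "\<eta> = a - b"
    unfolding extension_eq_sumset by blast
  obtain F1 where F1: "finite F1" "F1 \<subseteq> \<Gamma>" "a \<in> sumset (Suc n) F1"
    using sumset_finite_subset [OF \<eta>(3)] by blast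
  obtain F2 where F2: "finite F2" "F2 \<subseteq> \<Gamma>" "b \<in> sumset n F2"
    using sumset_finite_subset [OF \<eta>(4)] by blast
  \<comment> \<open>A single polynomial must have enough frequencies to produce both
    \<open>a\<close> and \<open>b\<close>.\<close>
  define F where "F = F1 \<union> F2"
  have F: "finite F" "F \<subseteq> \<Gamma>" "a \<in> sumset (Suc n) F" "b \<in> sumset n F"
    using F1 F2 subsetD [OF sumset_subset, of F1 F a "Suc n"] subsetD [OF sumset_subset, of F2 F b n]
    unfolding F_def by blast+
  have "\<eta> \<notin> F"
    using F \<eta> by blast
  define f where "f = trig_poly F (\<lambda>_. 1)"
  \<comment> \<open>The projection of \<open>u \<epsilon>\<close> is \<open>f\<close>. The minus
    sign is chosen because the derivative of the norm of \<open>f\<close> in the direction of the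
    character \<open>\<eta>\<close> will turn out to be positive.\<close>
  define u where "u = (\<lambda>\<epsilon> z. f z - complex_of_real \<epsilon> * mono z \<eta>)"
  define M where "M = real (card F)"
  have [measurable]: "f \<in> borel_measurable torus" "\<And>\<epsilon>. u \<epsilon> \<in> borel_measurable torus"
    unfolding f_def u_def by measurable
  define c where "c = (\<lambda>\<epsilon> \<alpha>. if \<alpha> = \<eta> then - complex_of_real \<epsilon> else 1)"
  have f_c: "f z = (\<Sum>\<alpha>\<in>F. c \<epsilon> \<alpha> * mono z \<alpha>)" for z \<epsilon>
    unfolding f_def trig_poly_def
  proof (rule sum.cong)
    fix \<alpha> assume "\<alpha> \<in> F"
    with \<open>\<eta> \<notin> F\<close> have "\<alpha> \<noteq> \<eta>"
      by blast
    then show "1 * mono z \<alpha> = c \<epsilon> \<alpha> * mono z \<alpha>"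
      by (simp add: c_def)
  qed simp
  have u_poly: "u \<epsilon> = trig_poly (insert \<eta> F) (c \<epsilon>)" for \<epsilon>
  proof
    fix z
    have "trig_poly (insert \<eta> F) (c \<epsilon>) z = c \<epsilon> \<eta> * mono z \<eta> + f z"
      unfolding trig_poly_def f_c [of z \<epsilon>] using F(1) \<open>\<eta> \<notin> F\<close> by (rule sum.insert)
    then show "u \<epsilon> z = trig_poly (insert \<eta> F) (c \<epsilon>) z"
      by (simp add: u_def c_def)
  qed
  have "insert \<eta> F \<inter> \<Gamma> = F"
    using F \<eta> by blast
  then have f_poly: "f = trig_poly (insert \<eta> F \<inter> \<Gamma>) (c \<epsilon>)" for \<epsilon>
    unfolding trig_poly_def by (intro ext) (simp only: f_c)
  have f_le: "cmod (f z) \<le> M" if "z \<in> unimodular" for z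
    using norm_trig_poly_le [OF that, of F "\<lambda>_. 1"] by (simp add: f_def M_def)
  have u_le: "cmod (u \<epsilon> z) \<le> M + 1" if "z \<in> unimodular" "\<bar>\<epsilon>\<bar> \<le> 1" for z \<epsilon>
  proof -
    have "cmod (u \<epsilon> z) \<le> cmod (f z) + cmod (complex_of_real \<epsilon> * mono z \<eta>)"
      unfolding u_def by (rule norm_triangle_ineq4)
    also have "\<dots> \<le> M + 1"
      using f_le [OF that(1)] that by (simp add: norm_mult norm_mono)
    finally show ?thesis .
  qed
  \<comment> \<open>Up to the factor \<open>2 * Suc n\<close>, this is the derivative of the power
    of the modulus at \<open>v\<close> in the direction of the character
    \<open>\<eta>\<close>.\<close>
  define D where "D = (\<lambda>v z. Re (v ^ n * cnj (v ^ Suc n) * mono z \<eta>))"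
  have D_le: "\<bar>D (u \<epsilon> z) z\<bar> \<le> (M + 1) ^ n * (M + 1) ^ Suc n" if "z \<in> unimodular" "\<bar>\<epsilon>\<bar> \<le> 1" for z \<epsilon>
  proof -
    have "\<bar>D (u \<epsilon> z) z\<bar> \<le> cmod (u \<epsilon> z ^ n * cnj (u \<epsilon> z ^ Suc n) * mono z \<eta>)"
      unfolding D_def by (rule abs_Re_le_cmod)
    also have "\<dots> \<le> (M + 1) ^ n * (M + 1) ^ Suc n"
      unfolding norm_mult complex_mod_cnj norm_power norm_mono [OF that(1)] mult_1_right
      by (intro mult_mono power_mono u_le that) (auto simp: M_def)
    finally show ?thesis .
  qed
  have D_meas: "(\<lambda>z. D (u \<epsilon> z) z) \<in> borel_measurable torus" for \<epsilon>
    unfolding D_def by measurable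
  have D_int: "integrable torus (\<lambda>z. D (u \<epsilon> z) z)" if "\<bar>\<epsilon>\<bar> \<le> 1" for \<epsilon>
    using D_le that by (intro torus_integrable_bounded [OF D_meas]) auto
  \<comment> \<open>The tangent is taken at \<open>u \<epsilon>\<close>, not at \<open>f\<close>:
    the power integral of \<open>f\<close> is at least that of \<open>u \<epsilon>\<close> plus a
    positive multiple of the integral of \<open>D\<close>, while contractivity makes it at most that
    of \<open>u \<epsilon>\<close>.\<close>
  have D_neg: "(\<integral>z. D (u \<epsilon> z) z \<partial>torus) \<le> 0" if \<epsilon>: "0 < \<epsilon>" "\<epsilon> \<le> 1" for \<epsilon>
  proof -
    have pow_int: "integrable torus (\<lambda>z. cmod (u \<epsilon> z) ^ (2 * Suc n))" "integrable torus (\<lambda>z. cmod (f z) ^ (2 * Suc n))"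
      unfolding u_poly f_def by (rule integrable_norm_trig_poly_power)+
    have "(\<integral>z. cmod (u \<epsilon> z) ^ (2 * Suc n) \<partial>torus) + 2 * Suc n * \<epsilon> * (\<integral>z. D (u \<epsilon> z) z \<partial>torus)
        = (\<integral>z. cmod (u \<epsilon> z) ^ (2 * Suc n) + 2 * Suc n * \<epsilon> * D (u \<epsilon> z) z \<partial>torus)"
      using D_int [of \<epsilon>] pow_int \<epsilon> by (subst Bochner_Integration.integral_add) auto
    also have "\<dots> \<le> (\<integral>z. cmod (f z) ^ (2 * Suc n) \<partial>torus)"
    proof (rule torus_integral_mono)
      fix z :: "'a \<Rightarrow> complex"
      have "f z - u \<epsilon> z = complex_of_real \<epsilon> * mono z \<eta>"
        by (simp add: u_def)
      moreover have "Re (w * m) * \<epsilon> = Re (w * (complex_of_real \<epsilon> * m))" for w m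
        by (simp add: algebra_simps)
      ultimately have "D (u \<epsilon> z) z * \<epsilon> = Re (u \<epsilon> z ^ n * cnj (u \<epsilon> z ^ Suc n) * (f z - u \<epsilon> z))"
        unfolding D_def by (simp only:)
      then show "cmod (u \<epsilon> z) ^ (2 * Suc n) + 2 * Suc n * \<epsilon> * D (u \<epsilon> z) z \<le> cmod (f z) ^ (2 * Suc n)"
        using norm_power_tangent_le [where a = "f z" and b = "u \<epsilon> z" and n = n]
        unfolding Re_norm_power_cnj by (simp only: mult.assoc mult.commute [of \<epsilon>])
    qed (use D_int [of \<epsilon>] pow_int \<epsilon> in auto)
    also have "\<dots> \<le> (\<integral>z. cmod (u \<epsilon> z) ^ (2 * Suc n) \<partial>torus)"
      unfolding u_poly f_poly [of \<epsilon>] using F \<eta> \<open>\<Gamma> \<subseteq> N0\<close> by (intro contr) auto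
    finally have "2 * Suc n * \<epsilon> * (\<integral>z. D (u \<epsilon> z) z \<partial>torus) \<le> 0"
      by simp
    then show ?thesis
      using \<epsilon> by (simp add: mult_le_0_iff)
  qed
  \<comment> \<open>The sign is carried from \<open>u \<epsilon>\<close> to \<open>u 0 = f\<close>
    by dominated convergence along \<open>\<epsilon> = 1 / (j + 1)\<close>.\<close>
  have "(\<lambda>j. \<integral>z. D (u (inverse (real (Suc j))) z) z \<partial>torus) \<longlonglongrightarrow> (\<integral>z. D (u 0 z) z \<partial>torus)"
  proof (rule integral_dominated_convergence [where w = "\<lambda>_. (M + 1) ^ n * (M + 1) ^ Suc n"])
    show "AE z in torus. (\<lambda>j. D (u (inverse (real (Suc j))) z) z) \<longlonglongrightarrow> D (u 0 z) z"
      unfolding D_def u_def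
      by (intro AE_I2 tendsto_intros LIMSEQ_inverse_real_of_nat)
    show "AE z in torus. norm (D (u (inverse (real (Suc j))) z) z) \<le> (M + 1) ^ n * (M + 1) ^ Suc n" for j
      using AE_unimodular by eventually_elim (use D_le in \<open>auto simp: field_simps\<close>)
  qed (auto intro: D_meas)
  then have "(\<integral>z. D (u 0 z) z \<partial>torus) \<le> 0"
    by (rule LIMSEQ_le_const2) (auto intro!: exI [of _ 0] D_neg simp: field_simps)
  \<comment> \<open>All coefficients of \<open>f\<close> are 1, so the pairing is a sum of positive
    terms, and the term with \<open>b + \<eta> = a\<close> shows that the sum is not empty.\<close>
  moreover have "0 < (\<integral>z. D (u 0 z) z \<partial>torus)"
  proof -
    obtain d e where de: "\<And>\<eta>. (\<integral>z. f z ^ n * cnj (f z ^ Suc n) * mono z \<eta> \<partial>torus)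
        = (\<Sum>b \<in> {b \<in> sumset n F. b + \<eta> \<in> sumset (Suc n) F}. d b * cnj (e (b + \<eta>)))"
      "(\<forall>\<alpha>\<in>F. (0::complex) < 1) \<longrightarrow> (\<forall>\<alpha>\<in>sumset n F. 0 < d \<alpha>)"
      "(\<forall>\<alpha>\<in>F. (0::complex) < 1) \<longrightarrow> (\<forall>\<alpha>\<in>sumset (Suc n) F. 0 < e \<alpha>)"
      unfolding f_def by (rule gradient_pairing [OF F(1), of "\<lambda>_. 1" n]) blast
    have one: "(0::complex) < 1"
      by (simp add: less_complex_def)
    have "b + \<eta> = a"
      unfolding \<eta>(5) by (simp add: fun_eq_iff)
    have "0 < (\<Sum>b \<in> {b \<in> sumset n F. b + \<eta> \<in> sumset (Suc n) F}. d b * cnj (e (b + \<eta>)))"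
    proof (rule sum_pos)
      show "finite {b \<in> sumset n F. b + \<eta> \<in> sumset (Suc n) F}"
        using finite_sumset [OF F(1)] by simp
      show "{b \<in> sumset n F. b + \<eta> \<in> sumset (Suc n) F} \<noteq> {}"
        using F \<open>b + \<eta> = a\<close> by blast
      fix x assume x: "x \<in> {b \<in> sumset n F. b + \<eta> \<in> sumset (Suc n) F}"
      have "0 < e (x + \<eta>)"
        using de(3) one x by blast
      then have "0 < cnj (e (x + \<eta>))"
        by (simp add: less_complex_def)
      then show "0 < d x * cnj (e (x + \<eta>))"
        using de(2) one x complex_mult_pos by blast
    qed
    then have "0 < Re (\<integral>z. f z ^ n * cnj (f z ^ Suc n) * mono z \<eta> \<partial>torus)"
      unfolding de(1) less_complex_def by simp
    also have "\<dots> = (\<integral>z. D (u 0 z) z \<partial>torus)"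
      using integral_Re [OF integrable_gradient_pairing, of F "\<lambda>_. 1" n "{\<eta>}" "\<lambda>_. 1"]
      by (simp add: D_def u_def f_def trig_poly_def [of "{\<eta>}"])
    finally show ?thesis .
  qed
  ultimately show False by simp
qed

section \<open>Completeness of mean-square convergence\<close>

text \<open>Fatou's lemma, arranged to yield integrability of the limit as well. The bound is
  assumed only eventually because a Cauchy estimate holds only far along the sequence.\<close>

lemma integrable_limit_bounded:
  fixes \<phi> :: "nat \<Rightarrow> 'a \<Rightarrow> real"
  assumes [measurable]: "\<And>j. \<phi> j \<in> borel_measurable M" "\<psi> \<in> borel_measurable M"
    and lim: "AE x in M. (\<lambda>j. \<phi> j x) \<longlonglongrightarrow> \<psi> x"
    and nonneg: "\<And>j x. 0 \<le> \<phi> j x" "\<And>x. 0 \<le> \<psi> x"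
    and bound: "\<forall>\<^sub>F j in sequentially. integrable M (\<phi> j) \<and> (\<integral>x. \<phi> j x \<partial>M) \<le> C"
    and "0 \<le> C"
  shows "integrable M \<psi>" "(\<integral>x. \<psi> x \<partial>M) \<le> C"
proof -
  have "(\<integral>\<^sup>+x. ennreal (\<psi> x) \<partial>M) = (\<integral>\<^sup>+x. liminf (\<lambda>j. ennreal (\<phi> j x)) \<partial>M)"
  proof (rule nn_integral_cong_AE)
    show "AE x in M. ennreal (\<psi> x) = liminf (\<lambda>j. ennreal (\<phi> j x))"
      using lim
    proof eventually_elim
      case (elim x)
      then have "(\<lambda>j. ennreal (\<phi> j x)) \<longlonglongrightarrow> ennreal (\<psi> x)"
        by (rule tendsto_ennrealI)
      then show ?case
        by (metis lim_imp_Liminf trivial_limit_sequentially)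
    qed
  qed
  also have "\<dots> \<le> liminf (\<lambda>j. \<integral>\<^sup>+x. ennreal (\<phi> j x) \<partial>M)"
    by (rule nn_integral_liminf) simp
  also have "\<dots> \<le> limsup (\<lambda>j. \<integral>\<^sup>+x. ennreal (\<phi> j x) \<partial>M)"
    by (rule Liminf_le_Limsup) simp
  also have "\<dots> \<le> ennreal C"
    using bound
    by (intro Limsup_bounded) (auto elim!: eventually_mono simp: nn_integral_eq_integral nonneg intro: ennreal_leI)
  finally have le: "(\<integral>\<^sup>+x. ennreal (\<psi> x) \<partial>M) \<le> ennreal C" .
  then have "(\<integral>\<^sup>+x. ennreal (\<psi> x) \<partial>M) < \<infinity>"
    by (rule order_le_less_trans) simp
  then show int: "integrable M \<psi>"
    using nonneg by (intro integrableI_nonneg) auto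
  show "(\<integral>x. \<psi> x \<partial>M) \<le> C"
    using le \<open>0 \<le> C\<close> nonneg by (simp add: nn_integral_eq_integral [OF int])
qed

lemma norm_add_squared_le:
  fixes a b :: "'a::real_normed_vector"
  shows "(norm (a + b))\<^sup>2 \<le> 2 * (norm a)\<^sup>2 + 2 * (norm b)\<^sup>2"
proof -
  have "(norm (a + b))\<^sup>2 \<le> (norm a + norm b)\<^sup>2"
    by (intro power_mono norm_triangle_ineq) simp
  also have "\<dots> \<le> 2 * (norm a)\<^sup>2 + 2 * (norm b)\<^sup>2"
    using zero_le_power2 [of "norm a - norm b"] by (simp add: power2_eq_square algebra_simps)
  finally show ?thesis .
qed

text \<open>A subsequence along which the squared distances decay geometrically converges almost
  everywhere, and Fatou's lemma turns its pointwise limit into the limit in mean square.\<close>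

lemma (in prob_space) L2_complete:
  fixes u :: "nat \<Rightarrow> 'a \<Rightarrow> 'b::{banach, second_countable_topology}"
  assumes [measurable]: "\<And>n. u n \<in> borel_measurable M"
    and int: "\<And>m n. integrable M (\<lambda>x. (norm (u m x - u n x))\<^sup>2)"
    and Cauchy: "\<And>\<epsilon>. 0 < \<epsilon> \<Longrightarrow> \<exists>N. \<forall>m\<ge>N. \<forall>n\<ge>N. (\<integral>x. (norm (u m x - u n x))\<^sup>2 \<partial>M) \<le> \<epsilon>"
  obtains g where "g \<in> borel_measurable M" "\<And>n. integrable M (\<lambda>x. (norm (g x - u n x))\<^sup>2)"
    "(\<lambda>n. \<integral>x. (norm (g x - u n x))\<^sup>2 \<partial>M) \<longlonglongrightarrow> 0"
proof -
  \<comment> \<open>The rate \<open>(1/4) ^ j\<close> for squares corresponds to the summable rate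
    \<open>(1/2) ^ j\<close> for norms.\<close>
  have "\<forall>j. \<exists>N. \<forall>m\<ge>N. \<forall>n\<ge>N. (\<integral>x. (norm (u m x - u n x))\<^sup>2 \<partial>M) \<le> (1/4) ^ j"
    using Cauchy by simp
  \<comment> \<open>In this proof \<open>N0\<close> is a threshold function, unrelated to the set of
    nonnegative multi-indices.\<close>
  then obtain N0 where N0: "\<And>j m n. N0 j \<le> m \<Longrightarrow> N0 j \<le> n \<Longrightarrow> (\<integral>x. (norm (u m x - u n x))\<^sup>2 \<partial>M) \<le> (1/4) ^ j"
    by metis
  \<comment> \<open>The partial sum dominates \<open>N0 j\<close> both at \<open>j\<close> and at
    \<open>Suc j\<close>, and the added \<open>j\<close> makes the indices tend to infinity.\<close>
  define r where "r = (\<lambda>j. j + (\<Sum>i\<le>j. N0 i))"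
  have r_ge: "j \<le> r j" "N0 j \<le> r j" "N0 j \<le> r (Suc j)" for j
  proof -
    have "N0 j \<le> (\<Sum>i\<le>j. N0 i)"
      by (rule member_le_sum) auto
    then show "j \<le> r j" "N0 j \<le> r j" "N0 j \<le> r (Suc j)"
      by (auto simp: r_def)
  qed
  define v where "v = (\<lambda>j x. u (r (Suc j)) x - u (r j) x)"
  have [measurable]: "v j \<in> borel_measurable M" for j
    unfolding v_def by measurable
  have v_int: "integrable M (\<lambda>x. (norm (v j x))\<^sup>2)" for j
    unfolding v_def by (rule int)
  have v_le: "(\<integral>x. (norm (v j x))\<^sup>2 \<partial>M) \<le> (1/4) ^ j" for j
    unfolding v_def by (intro N0 r_ge)
  have v_L1: "(\<integral>\<^sup>+x. ennreal (norm (v j x)) \<partial>M) \<le> ennreal ((1/2) ^ j)" for j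
  proof -
    \<comment> \<open>The inequality between arithmetic and geometric means with weight
      \<open>2 ^ j\<close>: it bounds the norm by its square plus a constant, balanced so that both
      have integral at most \<open>(1/2) ^ j\<close> on a probability space.\<close>
    define w where "w = (\<lambda>x. (2 ^ j * (norm (v j x))\<^sup>2 + (1/2) ^ j) / 2)"
    have w_int: "integrable M w"
      unfolding w_def using v_int [of j] by simp
    have vw: "norm (v j x) \<le> w x" for x
    proof -
      have "0 \<le> 2 ^ j * (norm (v j x) - (1/2) ^ j)\<^sup>2"
        by simp
      also have "\<dots> = 2 * w x - 2 * norm (v j x)"
        by (simp add: w_def power2_eq_square algebra_simps power_one_over)
      finally show ?thesis by simp
    qed
    have "(\<integral>\<^sup>+x. ennreal (norm (v j x)) \<partial>M) \<le> (\<integral>\<^sup>+x. ennreal (w x) \<partial>M)"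
      by (intro nn_integral_mono ennreal_leI vw)
    also have "\<dots> = ennreal (\<integral>x. w x \<partial>M)"
      using order_trans [OF norm_ge_zero vw] by (intro nn_integral_eq_integral w_int) auto
    also have "(\<integral>x. w x \<partial>M) = (2 ^ j * (\<integral>x. (norm (v j x))\<^sup>2 \<partial>M) + (1/2) ^ j) / 2"
      unfolding w_def using v_int [of j] by (simp add: prob_space)
    also have "ennreal \<dots> \<le> ennreal ((1/2) ^ j)"
    proof (rule ennreal_leI)
      have "2 ^ j * (\<integral>x. (norm (v j x))\<^sup>2 \<partial>M) \<le> 2 ^ j * (1/4) ^ j"
        by (intro mult_left_mono v_le) simp
      also have "\<dots> = (1/2 :: real) ^ j"
        by (simp flip: power_mult_distrib)
      finally show "(2 ^ j * (\<integral>x. (norm (v j x))\<^sup>2 \<partial>M) + (1/2) ^ j) / 2 \<le> (1/2) ^ j"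
        by simp
    qed
    finally show ?thesis .
  qed
  have "(\<integral>\<^sup>+x. (\<Sum>j. ennreal (norm (v j x))) \<partial>M) = (\<Sum>j. \<integral>\<^sup>+x. ennreal (norm (v j x)) \<partial>M)"
    by (rule nn_integral_suminf) simp
  also have "\<dots> \<le> (\<Sum>j. ennreal ((1/2) ^ j))"
    by (intro suminf_le v_L1 summableI)
  also have "\<dots> = ennreal (\<Sum>j. (1/2) ^ j)"
    by (intro suminf_ennreal2) auto
  finally have "(\<integral>\<^sup>+x. (\<Sum>j. ennreal (norm (v j x))) \<partial>M) \<noteq> \<infinity>"
    by (auto simp: top_unique)
  then have "AE x in M. (\<Sum>j. ennreal (norm (v j x))) \<noteq> \<infinity>"
    by (intro nn_integral_PInf_AE) auto
  then have conv: "AE x in M. (\<lambda>j. u (r j) x) \<longlonglongrightarrow> lim (\<lambda>j. u (r j) x)"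
  proof eventually_elim
    case (elim x)
    then have "summable (\<lambda>j. norm (v j x))"
      by (intro summable_suminf_not_top) auto
    then have "summable (\<lambda>j. v j x)"
      by (rule summable_norm_cancel)
    then have "convergent (\<lambda>J. (\<Sum>j<J. v j x) + u (r 0) x)"
      by (intro convergent_add convergent_const) (simp add: summable_iff_convergent)
    moreover have "(\<Sum>j<J. v j x) + u (r 0) x = u (r J) x" for J
      unfolding v_def by (simp add: sum_lessThan_telescope [of "\<lambda>j. u (r j) x"])
    ultimately show ?case
      by (simp add: convergent_LIMSEQ_iff)
  qed
  define g where "g = (\<lambda>x. lim (\<lambda>j. u (r j) x))"
  have [measurable]: "g \<in> borel_measurable M"
    unfolding g_def by measurable
  have close: "integrable M (\<lambda>x. (norm (g x - u m x))\<^sup>2) \<and> (\<integral>x. (norm (g x - u m x))\<^sup>2 \<partial>M) \<le> \<epsilon>"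
    if "0 < \<epsilon>" and N: "\<forall>m\<ge>N. \<forall>n\<ge>N. (\<integral>x. (norm (u m x - u n x))\<^sup>2 \<partial>M) \<le> \<epsilon>" and "N \<le> m" for \<epsilon> N m
  proof -
    have "AE x in M. (\<lambda>j. (norm (u (r j) x - u m x))\<^sup>2) \<longlonglongrightarrow> (norm (g x - u m x))\<^sup>2"
      using conv unfolding g_def by eventually_elim (intro tendsto_intros)
    moreover have "\<forall>\<^sub>F j in sequentially. integrable M (\<lambda>x. (norm (u (r j) x - u m x))\<^sup>2) \<and>
        (\<integral>x. (norm (u (r j) x - u m x))\<^sup>2 \<partial>M) \<le> \<epsilon>"
      using eventually_ge_at_top [of N]
    proof eventually_elim
      case (elim j)
      with r_ge(1) [of j] N \<open>N \<le> m\<close> int show ?case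
        by (meson order_trans)
    qed
    ultimately show ?thesis
      using integrable_limit_bounded [of "\<lambda>j x. (norm (u (r j) x - u m x))\<^sup>2" M "\<lambda>x. (norm (g x - u m x))\<^sup>2" \<epsilon>]
        \<open>0 < \<epsilon>\<close> by auto
  qed
  \<comment> \<open>\<open>close\<close> covers only indices beyond a threshold; for the other
    \<open>n\<close> the function \<open>u N\<close> serves as an intermediate point.\<close>
  have g_int: "integrable M (\<lambda>x. (norm (g x - u n x))\<^sup>2)" for n
  proof -
    obtain N where N: "\<forall>m\<ge>N. \<forall>n\<ge>N. (\<integral>x. (norm (u m x - u n x))\<^sup>2 \<partial>M) \<le> 1"
      using Cauchy [of 1] by auto
    have "integrable M (\<lambda>x. 2 * (norm (g x - u N x))\<^sup>2 + 2 * (norm (u N x - u n x))\<^sup>2)"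
      using close [OF _ N, of N] int [of N n] by simp
    then show ?thesis
    proof (rule Bochner_Integration.integrable_bound)
      show "AE x in M. norm ((norm (g x - u n x))\<^sup>2) \<le> norm (2 * (norm (g x - u N x))\<^sup>2 + 2 * (norm (u N x - u n x))\<^sup>2)"
        using norm_add_squared_le [of "g x - u N x" "u N x - u n x" for x] by (intro AE_I2) simp
    qed simp
  qed
  have "(\<lambda>n. \<integral>x. (norm (g x - u n x))\<^sup>2 \<partial>M) \<longlonglongrightarrow> 0"
  proof (rule LIMSEQ_I)
    fix e :: real assume "0 < e"
    then obtain N where N: "\<forall>m\<ge>N. \<forall>n\<ge>N. (\<integral>x. (norm (u m x - u n x))\<^sup>2 \<partial>M) \<le> e / 2"
      using Cauchy [of "e/2"] by auto
    have "norm ((\<integral>x. (norm (g x - u m x))\<^sup>2 \<partial>M) - 0) < e" if "N \<le> m" for m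
      using close [OF _ N that] \<open>0 < e\<close> by simp
    then show "\<exists>N. \<forall>m\<ge>N. norm ((\<integral>x. (norm (g x - u m x))\<^sup>2 \<partial>M) - 0) < e"
      by blast
  qed
  with that g_int \<open>g \<in> borel_measurable M\<close> show ?thesis
    by blast
qed

section \<open>Fejer means\<close>

definition freq_box :: "nat \<Rightarrow> ('d::finite \<Rightarrow> int) set" where
  "freq_box N = {\<alpha>. \<forall>i. 0 \<le> \<alpha> i \<and> \<alpha> i \<le> int N}"

definition box_diffs :: "nat \<Rightarrow> ('d::finite \<Rightarrow> int) set" where
  "box_diffs N = (\<lambda>p. fst p - snd p) ` (freq_box N \<times> freq_box N)"

text \<open>The proportion of box points \<open>\<alpha>\<close> for which
  \<open>\<alpha> - \<gamma>\<close> is again in the box. For large \<open>N\<close> this is the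
  product over \<open>i\<close> of the classical weights
  \<open>1 - \<bar>\<gamma> i\<bar> / (N + 1)\<close>; the counting form is what the square of a
  Dirichlet sum produces.\<close>

definition fejer_coeff :: "nat \<Rightarrow> ('d::finite \<Rightarrow> int) \<Rightarrow> real" where
  "fejer_coeff N \<gamma> = card {\<alpha> \<in> freq_box N. \<alpha> - \<gamma> \<in> freq_box N} / card (freq_box N :: ('d \<Rightarrow> int) set)"

lemma freq_box_eq_PiE: "freq_box N = PiE UNIV (\<lambda>_. {0..int N})"
  by (auto simp: freq_box_def PiE_def Pi_def)

lemma finite_box [simp]: "finite (freq_box N)"
  unfolding freq_box_eq_PiE by (rule finite_PiE) auto

lemma zero_in_box: "0 \<in> freq_box N"
  by (simp add: freq_box_def)

lemma freq_box_nonempty: "freq_box N \<noteq> {}"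
  using zero_in_box by blast

lemma card_box_pos: "0 < card (freq_box N)"
  by (simp add: card_gt_0_iff freq_box_nonempty)

lemma finite_box_diffs [simp]: "finite (box_diffs N)"
  by (simp add: box_diffs_def)

lemma fejer_coeff_nonneg: "0 \<le> fejer_coeff N \<gamma>"
  by (simp add: fejer_coeff_def)

lemma fejer_coeff_le_1:
  fixes \<gamma> :: "'d::finite \<Rightarrow> int"
  shows "fejer_coeff N \<gamma> \<le> 1"
proof -
  have "card {\<alpha> \<in> freq_box N. \<alpha> - \<gamma> \<in> freq_box N} \<le> card (freq_box N :: ('d \<Rightarrow> int) set)"
    by (intro card_mono) auto
  then show ?thesis
    by (simp add: fejer_coeff_def divide_le_eq_1 card_box_pos)
qed

lemma fejer_coeff_0: "fejer_coeff N (0 :: 'd::finite \<Rightarrow> int) = 1"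
proof -
  have "{\<alpha> \<in> freq_box N. \<alpha> - (0 :: 'd \<Rightarrow> int) \<in> freq_box N} = freq_box N"
    unfolding diff_zero by blast
  moreover have "real (card (freq_box N :: ('d \<Rightarrow> int) set)) \<noteq> 0"
    by (simp add: freq_box_nonempty)
  ultimately show ?thesis
    unfolding fejer_coeff_def by simp
qed

lemma zero_in_box_diffs: "0 \<in> box_diffs N"
  unfolding box_diffs_def using zero_in_box by (intro image_eqI [of _ _ "(0, 0)"]) auto

lemma fejer_coeff_outside:
  assumes "\<gamma> \<notin> box_diffs N"
  shows "fejer_coeff N \<gamma> = 0"
proof -
  have False if "\<alpha> \<in> freq_box N" "\<alpha> - \<gamma> \<in> freq_box N" for \<alpha>
  proof -
    have "\<gamma> = fst (\<alpha>, \<alpha> - \<gamma>) - snd (\<alpha>, \<alpha> - \<gamma>)"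
      by (simp add: fun_eq_iff)
    then show False
      using assms that unfolding box_diffs_def by blast
  qed
  then have "{\<alpha> \<in> freq_box N. \<alpha> - \<gamma> \<in> freq_box N} = {}"
    by blast
  then show ?thesis
    unfolding fejer_coeff_def by (simp only: card.empty of_nat_0 div_0)
qed

text \<open>Once \<open>N\<close> exceeds every \<open>\<bar>\<gamma> i\<bar>\<close>, the counted
  points form a product of integer intervals with \<open>N + 1 - \<bar>\<gamma> i\<bar>\<close>
  elements, which gives the product formula and its limit.\<close>

lemma fejer_coeff_tendsto_1:
  fixes \<gamma> :: "'d::finite \<Rightarrow> int"
  shows "(\<lambda>N. fejer_coeff N \<gamma>) \<longlonglongrightarrow> 1"
proof -
  have eq: "fejer_coeff N \<gamma> = (\<Prod>i\<in>UNIV. 1 - of_int \<bar>\<gamma> i\<bar> * inverse (real (Suc N)))"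
    if N: "\<And>i. \<bar>\<gamma> i\<bar> \<le> int N" for N
  proof -
    have "{\<alpha> \<in> freq_box N. \<alpha> - \<gamma> \<in> freq_box N} = PiE UNIV (\<lambda>i. {max 0 (\<gamma> i)..min (int N) (int N + \<gamma> i)})"
      by (auto simp: freq_box_def PiE_def Pi_def algebra_simps)
    moreover have "real (card {max 0 (\<gamma> i)..min (int N) (int N + \<gamma> i)}) = real_of_int (int (Suc N) - \<bar>\<gamma> i\<bar>)" for i
      using N [of i] by (cases "0 \<le> \<gamma> i") auto
    ultimately have "real (card {\<alpha> \<in> freq_box N. \<alpha> - \<gamma> \<in> freq_box N}) = (\<Prod>i\<in>UNIV. real_of_int (int (Suc N) - \<bar>\<gamma> i\<bar>))"
      by (simp only: card_PiE finite of_nat_prod)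
    moreover have "real (card (freq_box N :: ('d \<Rightarrow> int) set)) = (\<Prod>i\<in>(UNIV::'d set). real (Suc N))"
      unfolding freq_box_eq_PiE by (simp add: card_PiE add.commute)
    ultimately have "fejer_coeff N \<gamma> = (\<Prod>i\<in>UNIV. real_of_int (int (Suc N) - \<bar>\<gamma> i\<bar>) / real (Suc N))"
      unfolding fejer_coeff_def by (simp only: prod_dividef)
    also have "\<dots> = (\<Prod>i\<in>UNIV. 1 - of_int \<bar>\<gamma> i\<bar> * inverse (real (Suc N)))"
      by (rule prod.cong) (auto simp: field_simps)
    finally show ?thesis .
  qed
  have "(\<lambda>N. \<Prod>i\<in>(UNIV::'d set). 1 - of_int \<bar>\<gamma> i\<bar> * inverse (real (Suc N))) \<longlonglongrightarrow> (\<Prod>i\<in>(UNIV::'d set). 1 - of_int \<bar>\<gamma> i\<bar> * 0)"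
    by (intro tendsto_intros LIMSEQ_inverse_real_of_nat)
  moreover have "\<forall>\<^sub>F N in sequentially. fejer_coeff N \<gamma> = (\<Prod>i\<in>UNIV. 1 - of_int \<bar>\<gamma> i\<bar> * inverse (real (Suc N)))"
    using eventually_ge_at_top [of "nat (\<Sum>i\<in>UNIV. \<bar>\<gamma> i\<bar>)"]
  proof eventually_elim
    case (elim N)
    have "\<bar>\<gamma> i\<bar> \<le> (\<Sum>i\<in>UNIV. \<bar>\<gamma> i\<bar>)" for i
      by (rule member_le_sum) auto
    with elim show ?case
      by (intro eq) (meson nat_le_iff order_trans)
  qed
  ultimately show ?thesis
    by (simp add: tendsto_cong)
qed

section \<open>Averaging against the Fejer kernel\<close>

definition fejer_kernel :: "nat \<Rightarrow> ('d::finite \<Rightarrow> complex) \<Rightarrow> ('d \<Rightarrow> complex) \<Rightarrow> real" where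
  "fejer_kernel N z u = (cmod (\<Sum>\<alpha>\<in>freq_box N. mono z \<alpha> * cnj (mono u \<alpha>)))\<^sup>2 / card (freq_box N :: ('d \<Rightarrow> int) set)"

definition fejer_mean :: "nat \<Rightarrow> (('d::finite \<Rightarrow> complex) \<Rightarrow> complex) \<Rightarrow> ('d \<Rightarrow> complex) \<Rightarrow> complex" where
  "fejer_mean N f = trig_poly (box_diffs N) (\<lambda>\<gamma>. complex_of_real (fejer_coeff N \<gamma>) * fourier f \<gamma>)"

lemma measurable_fejer_kernel [measurable]: "fejer_kernel N z \<in> borel_measurable torus"
  unfolding fejer_kernel_def by measurable

lemma fejer_kernel_nonneg: "0 \<le> fejer_kernel N z u"
  by (simp add: fejer_kernel_def)

text \<open>The kernel is a normalised squared Dirichlet sum, hence nonnegative by construction.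
  Expanding the square and grouping pairs by their difference gives the weights
  \<open>fejer_coeff\<close>; a fibre is parametrised by its first component.\<close>

lemma fejer_kernel_expansion:
  fixes z u :: "'d::finite \<Rightarrow> complex"
  assumes z: "z \<in> unimodular" and u: "u \<in> unimodular"
  shows "complex_of_real (fejer_kernel N z u)
    = (\<Sum>\<gamma>\<in>box_diffs N. complex_of_real (fejer_coeff N \<gamma>) * mono z \<gamma> * cnj (mono u \<gamma>))"
proof -
  let ?B = "freq_box N :: ('d \<Rightarrow> int) set"
  let ?S = "\<Sum>\<alpha>\<in>?B. mono z \<alpha> * cnj (mono u \<alpha>)"
  let ?h = "\<lambda>\<gamma>. mono z \<gamma> * cnj (mono u \<gamma>)"
  have fibre: "card {p \<in> ?B \<times> ?B. fst p - snd p = \<gamma>} = card {\<alpha> \<in> ?B. \<alpha> - \<gamma> \<in> ?B}" for \<gamma>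
  proof (rule sym, rule bij_betw_same_card, rule bij_betwI [where g = fst])
    show "(\<lambda>\<alpha>. (\<alpha>, \<alpha> - \<gamma>)) \<in> {\<alpha> \<in> ?B. \<alpha> - \<gamma> \<in> ?B} \<rightarrow> {p \<in> ?B \<times> ?B. fst p - snd p = \<gamma>}"
      by (auto simp: fun_eq_iff)
    show "fst \<in> {p \<in> ?B \<times> ?B. fst p - snd p = \<gamma>} \<rightarrow> {\<alpha> \<in> ?B. \<alpha> - \<gamma> \<in> ?B}"
      by (auto simp: fun_diff_def)
  qed (auto simp: fun_eq_iff algebra_simps)
  have "complex_of_real ((cmod ?S)\<^sup>2) = ?S * cnj ?S"
    by (rule complex_norm_square)
  also have "\<dots> = (\<Sum>p\<in>?B \<times> ?B. ?h (fst p - snd p))"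
    unfolding cnj_sum sum_product sum.cartesian_product
    by (rule sum.cong) (simp_all add: case_prod_unfold mono_diff z u mult_ac del: fun_diff_def)
  also have "\<dots> = (\<Sum>\<gamma>\<in>box_diffs N. \<Sum>p\<in>{p \<in> ?B \<times> ?B. fst p - snd p = \<gamma>}. ?h (fst p - snd p))"
    unfolding box_diffs_def by (rule sum.image_gen) simp
  also have "\<dots> = (\<Sum>\<gamma>\<in>box_diffs N. \<Sum>p\<in>{p \<in> ?B \<times> ?B. fst p - snd p = \<gamma>}. ?h \<gamma>)"
    by (intro sum.cong refl) auto
  also have "\<dots> = (\<Sum>\<gamma>\<in>box_diffs N. of_nat (card {\<alpha> \<in> ?B. \<alpha> - \<gamma> \<in> ?B}) * ?h \<gamma>)"
    unfolding sum_constant fibre ..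
  finally show ?thesis
    unfolding fejer_kernel_def of_real_divide
    by (simp add: fejer_coeff_def sum_divide_distrib mult.assoc)
qed

lemma fejer_kernel_le:
  fixes z u :: "'d::finite \<Rightarrow> complex"
  assumes "z \<in> unimodular" "u \<in> unimodular"
  shows "fejer_kernel N z u \<le> (real (card (freq_box N :: ('d \<Rightarrow> int) set)))\<^sup>2 / card (freq_box N :: ('d \<Rightarrow> int) set)"
proof -
  have "cmod (\<Sum>\<alpha>\<in>freq_box N. mono z \<alpha> * cnj (mono u \<alpha>)) \<le> (\<Sum>\<alpha>\<in>(freq_box N :: ('d \<Rightarrow> int) set). 1)"
    using assms by (intro sum_norm_le) (simp add: norm_mult norm_mono)
  then show ?thesis
    unfolding fejer_kernel_def by (intro divide_right_mono power_mono) auto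
qed

lemma integrable_mult_fejer_kernel:
  fixes f :: "('d::finite \<Rightarrow> complex) \<Rightarrow> 'b::{real_normed_field, banach, second_countable_topology}"
  assumes f: "integrable torus f" and z: "z \<in> unimodular"
  shows "integrable torus (\<lambda>u. f u * of_real (fejer_kernel N z u))"
proof -
  let ?K = "(real (card (freq_box N :: ('d \<Rightarrow> int) set)))\<^sup>2 / card (freq_box N :: ('d \<Rightarrow> int) set)"
  have [measurable]: "f \<in> borel_measurable torus"
    using f by simp
  have "integrable torus (\<lambda>u. f u * of_real ?K)"
    using f by simp
  then show ?thesis
  proof (rule Bochner_Integration.integrable_bound)
    show "AE u in torus. norm (f u * of_real (fejer_kernel N z u)) \<le> norm (f u * of_real ?K)"
      using AE_unimodular
    proof eventually_elim
      case (elim u)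
      show ?case
        unfolding norm_mult norm_of_real
        using fejer_kernel_le [OF z elim, of N] fejer_kernel_nonneg [of N z u] by (intro mult_left_mono) auto
    qed
  qed measurable
qed

lemma integrable_mult_cnj_mono:
  assumes "integrable torus f"
  shows "integrable torus (\<lambda>z. f z * cnj (mono z \<alpha>))"
  using assms
proof (rule Bochner_Integration.integrable_bound)
  show "AE z in torus. norm (f z * cnj (mono z \<alpha>)) \<le> norm (f z)"
    using AE_unimodular by eventually_elim (simp add: norm_mult norm_mono)
qed (use assms in measurable)

text \<open>Links the two faces of the Fejer mean: the coefficient form exhibits a polynomial whose
  frequencies are under control, the integral form an average to which Jensen's inequality
  applies.\<close>

lemma fejer_mean_eq_integral:
  assumes f: "integrable torus f" and z: "z \<in> unimodular"
  shows "fejer_mean N f z = (\<integral>u. f u * complex_of_real (fejer_kernel N z u) \<partial>torus)"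
proof -
  have [measurable]: "f \<in> borel_measurable torus"
    using f by simp
  have "(\<integral>u. f u * complex_of_real (fejer_kernel N z u) \<partial>torus)
    = (\<integral>u. (\<Sum>\<gamma>\<in>box_diffs N. (complex_of_real (fejer_coeff N \<gamma>) * mono z \<gamma>) * (f u * cnj (mono u \<gamma>))) \<partial>torus)"
    by (rule torus_integral_cong)
       (auto simp: fejer_kernel_expansion [OF z] sum_distrib_left mult_ac)
  also have "\<dots> = fejer_mean N f z"
    by (simp add: integrable_mult_cnj_mono [OF f] fejer_mean_def trig_poly_def fourier_def)
       (simp only: mult_ac)
  finally show ?thesis by simp
qed

lemma mono_0 [simp]: "mono z 0 = 1"
  by (simp add: mono_def)

text \<open>Integration keeps only the zeroth coefficient, whose Fejer weight is 1. Applied to a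
  power of the modulus of \<open>f\<close>, this evaluates the integral of Jensen's upper
  bound.\<close>

lemma integral_fejer_mean: "(\<integral>z. fejer_mean N f z \<partial>torus) = (\<integral>z. f z \<partial>torus)"
proof -
  have "(\<integral>z. fejer_mean N f z \<partial>torus) = fourier (fejer_mean N f) 0"
    by (simp add: fourier_def)
  also have "\<dots> = fourier f 0"
    unfolding fejer_mean_def by (simp add: fourier_trig_poly zero_in_box_diffs fejer_coeff_0)
  also have "\<dots> = (\<integral>z. f z \<partial>torus)"
    by (simp add: fourier_def)
  finally show ?thesis .
qed

lemma integral_fejer_kernel:
  fixes z :: "'d::finite \<Rightarrow> complex"
  assumes z: "z \<in> unimodular"
  shows "(\<integral>u. fejer_kernel N z u \<partial>torus) = 1"
proof -
  have one: "(\<lambda>_. 1) = trig_poly {0} (\<lambda>_. 1)"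
    by (simp add: trig_poly_def fun_eq_iff)
  have "complex_of_real (\<integral>u. fejer_kernel N z u \<partial>torus) = fejer_mean N (\<lambda>_. 1) z"
    by (subst fejer_mean_eq_integral [OF _ z]) auto
  also have "\<dots> = (\<Sum>\<gamma>\<in>(box_diffs N :: ('d \<Rightarrow> int) set). if \<gamma> = 0 then 1 else 0)"
    unfolding fejer_mean_def trig_poly_def [of "box_diffs N"] unfolding one
    by (intro sum.cong) (auto simp: fourier_trig_poly fejer_coeff_0)
  also have "\<dots> = 1"
    by (simp add: zero_in_box_diffs)
  finally show ?thesis
    by (metis of_real_1 of_real_eq_iff)
qed

text \<open>Jensen's inequality for the probability density \<open>fejer_kernel N z\<close>.\<close>

lemma norm_fejer_mean_power_le:
  assumes [measurable]: "f \<in> borel_measurable torus"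
    and int: "integrable torus f" "integrable torus (\<lambda>u. cmod (f u) ^ Suc m)" and z: "z \<in> unimodular"
  shows "cmod (fejer_mean N f z) ^ Suc m \<le> (\<integral>u. cmod (f u) ^ Suc m * fejer_kernel N z u \<partial>torus)"
proof -
  let ?k = "fejer_kernel N z"
  define s where "s = (\<integral>u. cmod (f u) * ?k u \<partial>torus)"
  have k_int: "integrable torus ?k"
    using integrable_mult_fejer_kernel [of "\<lambda>_. 1 :: real", OF _ z] by simp
  have fk_int: "integrable torus (\<lambda>u. cmod (f u) * ?k u)"
    using integrable_mult_fejer_kernel [OF integrable_norm [OF int(1)] z] by simp
  have pk_int: "integrable torus (\<lambda>u. cmod (f u) ^ Suc m * ?k u)"
    using integrable_mult_fejer_kernel [OF int(2) z] by simp
  have "cmod (fejer_mean N f z) \<le> (\<integral>u. cmod (f u * complex_of_real (?k u)) \<partial>torus)"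
    unfolding fejer_mean_eq_integral [OF int(1) z] by (rule integral_norm_bound)
  also have "\<dots> = s"
    unfolding s_def by (simp add: norm_mult fejer_kernel_nonneg)
  finally have le: "cmod (fejer_mean N f z) \<le> s" .
  then have "0 \<le> s"
    using norm_ge_zero order_trans by blast
  \<comment> \<open>The tangent line at the mean \<open>s\<close> is integrated against the kernel.
    Because the kernel has mass 1 and \<open>s\<close> is the average of the modulus, the linear
    term contributes 0.\<close>
  have "s ^ Suc m = (\<integral>u. (s ^ Suc m - Suc m * s ^ m * s) * ?k u + Suc m * s ^ m * (cmod (f u) * ?k u) \<partial>torus)"
    using k_int fk_int by (simp add: integral_fejer_kernel [OF z] flip: s_def)
  also have "\<dots> \<le> (\<integral>u. cmod (f u) ^ Suc m * ?k u \<partial>torus)"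
  proof (rule torus_integral_mono)
    fix u :: "'a \<Rightarrow> complex"
    have "(s ^ Suc m + Suc m * s ^ m * (cmod (f u) - s)) * ?k u \<le> cmod (f u) ^ Suc m * ?k u"
      using \<open>0 \<le> s\<close> by (intro mult_right_mono power_tangent_le fejer_kernel_nonneg) auto
    then show "(s ^ Suc m - Suc m * s ^ m * s) * ?k u + Suc m * s ^ m * (cmod (f u) * ?k u) \<le> cmod (f u) ^ Suc m * ?k u"
      by (simp add: algebra_simps)
  qed (use k_int fk_int pk_int in auto)
  finally show ?thesis
    using power_mono [OF le, of "Suc m"] by simp
qed

text \<open>Jensen's bound at \<open>z\<close> is itself a Fejer mean, namely that of the power of
  the modulus of \<open>f\<close>, and Fejer means preserve integrals. The power is made
  complex-valued as \<open>\<phi>\<close> so that \<open>fejer_mean\<close> applies to it.\<close>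

lemma fejer_mean_contractive:
  assumes [measurable]: "f \<in> borel_measurable torus"
    and int: "integrable torus f" "integrable torus (\<lambda>u. cmod (f u) ^ Suc m)"
  shows "(\<integral>z. cmod (fejer_mean N f z) ^ Suc m \<partial>torus) \<le> (\<integral>z. cmod (f z) ^ Suc m \<partial>torus)"
proof -
  define \<phi> where "\<phi> = (\<lambda>u. complex_of_real (cmod (f u) ^ Suc m))"
  have \<phi>: "integrable torus \<phi>"
    unfolding \<phi>_def using int(2) by (rule integrable_of_real)
  have mean_int: "integrable torus (fejer_mean N g)" for g :: "('a \<Rightarrow> complex) \<Rightarrow> complex"
    unfolding fejer_mean_def by (rule torus_integrable_bounded [OF _ norm_trig_poly_le]) measurable
  have "(\<integral>z. cmod (fejer_mean N f z) ^ Suc m \<partial>torus) \<le> (\<integral>z. Re (fejer_mean N \<phi> z) \<partial>torus)"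
  proof (rule torus_integral_mono)
    fix z :: "'a \<Rightarrow> complex" assume z: "z \<in> unimodular"
    have "fejer_mean N \<phi> z = (\<integral>u. complex_of_real (cmod (f u) ^ Suc m * fejer_kernel N z u) \<partial>torus)"
      unfolding fejer_mean_eq_integral [OF \<phi> z] by (simp add: \<phi>_def)
    also have "\<dots> = complex_of_real (\<integral>u. cmod (f u) ^ Suc m * fejer_kernel N z u \<partial>torus)"
      by (rule integral_complex_of_real)
    finally show "cmod (fejer_mean N f z) ^ Suc m \<le> Re (fejer_mean N \<phi> z)"
      using norm_fejer_mean_power_le [OF assms z, of N] by simp
  next
    show "integrable torus (\<lambda>z. cmod (fejer_mean N f z) ^ Suc m)"
      unfolding fejer_mean_def by (rule integrable_norm_trig_poly_power)
    show "integrable torus (\<lambda>z. Re (fejer_mean N \<phi> z))"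
      by (rule integrable_Re) (rule mean_int)
  qed
  also have "\<dots> = Re (\<integral>z. fejer_mean N \<phi> z \<partial>torus)"
    by (rule integral_Re) (rule mean_int)
  also have "\<dots> = (\<integral>z. cmod (f z) ^ Suc m \<partial>torus)"
    unfolding integral_fejer_mean unfolding \<phi>_def integral_complex_of_real by simp
  finally show ?thesis .
qed

section \<open>Projections in mean square\<close>

definition square_integrable :: "(('d::finite \<Rightarrow> complex) \<Rightarrow> complex) \<Rightarrow> bool" where
  "square_integrable f \<longleftrightarrow> f \<in> borel_measurable torus \<and> integrable torus (\<lambda>z. (cmod (f z))\<^sup>2)"

lemma square_integrable_measurable [measurable_dest]: "square_integrable f \<Longrightarrow> f \<in> borel_measurable torus"
  by (simp add: square_integrable_def)

lemma square_integrable_imp_integrable: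
  assumes "square_integrable f"
  shows "integrable torus f"
proof -
  have [measurable]: "f \<in> borel_measurable torus"
    using assms by measurable
  have "integrable torus (\<lambda>z. 1 + (cmod (f z))\<^sup>2)"
    using assms by (simp add: square_integrable_def)
  then show ?thesis
  proof (rule Bochner_Integration.integrable_bound)
    show "AE z in torus. cmod (f z) \<le> norm (1 + (cmod (f z))\<^sup>2)"
    proof (rule AE_I2)
      fix z
      have "2 * cmod (f z) \<le> 1 + (cmod (f z))\<^sup>2"
        using zero_le_power2 [of "cmod (f z) - 1"] by (simp add: power2_eq_square algebra_simps)
      then have "cmod (f z) \<le> 1 + (cmod (f z))\<^sup>2"
        using norm_ge_zero [of "f z"] by linarith
      then show "cmod (f z) \<le> norm (1 + (cmod (f z))\<^sup>2)"
        by simp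
    qed
  qed measurable
qed

lemma square_integrable_add:
  assumes "square_integrable f" "square_integrable g"
  shows "square_integrable (\<lambda>z. f z + g z)"
proof -
  have [measurable]: "f \<in> borel_measurable torus" "g \<in> borel_measurable torus"
    using assms by measurable
  have "integrable torus (\<lambda>z. 2 * (cmod (f z))\<^sup>2 + 2 * (cmod (g z))\<^sup>2)"
    using assms by (simp add: square_integrable_def)
  then have "integrable torus (\<lambda>z. (cmod (f z + g z))\<^sup>2)"
    by (rule Bochner_Integration.integrable_bound) (auto intro!: AE_I2 norm_add_squared_le)
  then show ?thesis
    by (simp add: square_integrable_def)
qed

lemma square_integrable_scale:
  "square_integrable f \<Longrightarrow> square_integrable (\<lambda>z. a * f z)"
  by (auto simp: square_integrable_def norm_mult power_mult_distrib)

lemma square_integrable_diff: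
  assumes "square_integrable f" "square_integrable g"
  shows "square_integrable (\<lambda>z. f z - g z)"
  using square_integrable_add [OF assms(1) square_integrable_scale [OF assms(2), of "-1"]] by simp

lemma square_integrable_trig_poly: "square_integrable (trig_poly F c)"
  by (simp add: square_integrable_def integrable_norm_trig_poly_power)

lemma fourier_add:
  assumes "integrable torus f" "integrable torus g"
  shows "fourier (\<lambda>z. f z + g z) \<alpha> = fourier f \<alpha> + fourier g \<alpha>"
  unfolding fourier_def distrib_right
  by (intro Bochner_Integration.integral_add integrable_mult_cnj_mono assms)

lemma fourier_scale: "fourier (\<lambda>z. a * f z) \<alpha> = a * fourier f \<alpha>"
  by (simp add: fourier_def mult.assoc)

lemma fourier_diff:
  assumes "integrable torus f" "integrable torus g"
  shows "fourier (\<lambda>z. f z - g z) \<alpha> = fourier f \<alpha> - fourier g \<alpha>"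
  unfolding fourier_def left_diff_distrib
  by (intro Bochner_Integration.integral_diff integrable_mult_cnj_mono assms)

lemma bessel_inequality:
  assumes f: "square_integrable f" and "finite A"
  shows "(\<Sum>\<alpha>\<in>A. (cmod (fourier f \<alpha>))\<^sup>2) \<le> (\<integral>z. (cmod (f z))\<^sup>2 \<partial>torus)"
proof -
  let ?h = "trig_poly A (fourier f)"
  let ?S = "\<Sum>\<alpha>\<in>A. (cmod (fourier f \<alpha>))\<^sup>2"
  note f_int = square_integrable_imp_integrable [OF f]
  have fh: "(\<lambda>z. f z * cnj (?h z)) = (\<lambda>z. \<Sum>\<alpha>\<in>A. cnj (fourier f \<alpha>) * (f z * cnj (mono z \<alpha>)))"
    by (simp add: trig_poly_def sum_distrib_left mult_ac)
  have fh_int: "integrable torus (\<lambda>z. f z * cnj (?h z))"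
    unfolding fh by (intro Bochner_Integration.integrable_sum integrable_mult_right integrable_mult_cnj_mono f_int)
  have "(\<integral>z. f z * cnj (?h z) \<partial>torus) = (\<Sum>\<alpha>\<in>A. cnj (fourier f \<alpha>) * fourier f \<alpha>)"
    unfolding fh by (simp add: integrable_mult_cnj_mono f_int fourier_def)
  also have "\<dots> = complex_of_real ?S"
    unfolding of_real_sum complex_norm_square by (simp only: mult.commute)
  finally have "Re (\<integral>z. f z * cnj (?h z) \<partial>torus) = ?S"
    by (simp only: Re_complex_of_real)
  then have cross: "(\<integral>z. Re (f z * cnj (?h z)) \<partial>torus) = ?S"
    using integral_Re [OF fh_int] by (simp only:)
  have pt: "(cmod (f z - ?h z))\<^sup>2 = (cmod (f z))\<^sup>2 - 2 * Re (f z * cnj (?h z)) + (cmod (?h z))\<^sup>2" for z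
    by (simp only: cmod_power2) (simp add: power2_eq_square algebra_simps)
  have "0 \<le> (\<integral>z. (cmod (f z - ?h z))\<^sup>2 \<partial>torus)"
    by simp
  also have "\<dots> = (\<integral>z. (cmod (f z))\<^sup>2 \<partial>torus) - 2 * ?S + (\<integral>z. (cmod (?h z))\<^sup>2 \<partial>torus)"
    unfolding pt using f integrable_Re [OF fh_int] integrable_norm_trig_poly_power [of A "fourier f" 2] cross
    by (simp add: square_integrable_def del: times_complex.sel)
  also have "(\<integral>z. (cmod (?h z))\<^sup>2 \<partial>torus) = ?S"
    using assms(2) by (rule integral_norm_trig_poly_squared)
  finally show ?thesis by simp
qed

text \<open>The projection of a Fejer mean. The Fejer weights, in place of a sharp cutoff, keep its
  norm bounded by that of \<open>f\<close> when the projection is contractive on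
  polynomials.\<close>

definition fejer_proj :: "('d::finite \<Rightarrow> int) set \<Rightarrow> nat \<Rightarrow> (('d \<Rightarrow> complex) \<Rightarrow> complex) \<Rightarrow> ('d \<Rightarrow> complex) \<Rightarrow> complex" where
  "fejer_proj \<Gamma> N f = trig_poly (box_diffs N \<inter> \<Gamma>) (\<lambda>\<gamma>. complex_of_real (fejer_coeff N \<gamma>) * fourier f \<gamma>)"

lemma trig_poly_mono_neutral:
  assumes "finite G" "F \<subseteq> G" "\<And>\<alpha>. \<alpha> \<in> G - F \<Longrightarrow> c \<alpha> = 0"
  shows "trig_poly F c = trig_poly G c"
  unfolding trig_poly_def using assms by (intro ext sum.mono_neutral_left) auto

lemma square_integrable_fejer_proj: "square_integrable (fejer_proj \<Gamma> N f)"
  unfolding fejer_proj_def by (rule square_integrable_trig_poly)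

lemma measurable_fejer_proj [measurable]: "fejer_proj \<Gamma> N f \<in> borel_measurable torus"
  unfolding fejer_proj_def by measurable

lemma fejer_proj_extend:
  assumes "finite G" "box_diffs N \<subseteq> G"
  shows "fejer_proj \<Gamma> N f = trig_poly (G \<inter> \<Gamma>) (\<lambda>\<gamma>. complex_of_real (fejer_coeff N \<gamma>) * fourier f \<gamma>)"
  unfolding fejer_proj_def using assms
  by (intro trig_poly_mono_neutral) (auto simp: fejer_coeff_outside)

lemma trig_poly_diff: "trig_poly F c z - trig_poly F d z = trig_poly F (\<lambda>\<alpha>. c \<alpha> - d \<alpha>) z"
  by (simp add: trig_poly_def left_diff_distrib sum_subtractf)

text \<open>Choose \<open>A\<close> with sum within \<open>\<epsilon>\<close> of the supremum of all
  finite sums; a disjoint set of larger sum would push the union above that supremum.\<close>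

lemma finite_sums_bounded_tail:
  fixes a :: "'b \<Rightarrow> real"
  assumes nonneg: "\<And>x. 0 \<le> a x" and bound: "\<And>X. finite X \<Longrightarrow> sum a X \<le> B" and "0 < \<epsilon>"
  obtains A where "finite A" "\<And>X. finite X \<Longrightarrow> X \<inter> A = {} \<Longrightarrow> sum a X \<le> \<epsilon>"
proof -
  let ?S = "sum a ` {X. finite X}"
  have bdd: "bdd_above ?S"
    using bound by (intro bdd_aboveI [of _ B]) auto
  have "\<exists>x\<in>?S. Sup ?S - \<epsilon> < x"
    using \<open>0 < \<epsilon>\<close> by (intro less_cSupD) auto
  then obtain A where A: "finite A" "Sup ?S - \<epsilon> < sum a A"
    by blast
  have "sum a X \<le> \<epsilon>" if "finite X" "X \<inter> A = {}" for X
  proof -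
    have "sum a X + sum a A = sum a (X \<union> A)"
      using that A by (simp add: sum.union_disjoint)
    also have "\<dots> \<le> Sup ?S"
      using that A by (intro cSup_upper bdd) auto
    finally show ?thesis using A by simp
  qed
  with A that show ?thesis by blast
qed

text \<open>By orthogonality the squared distance is a sum of squared Fourier coefficients weighted
  by squared differences of Fejer weights. Off a finite set \<open>A\<close> these differences are
  at most 1 and the tail from Bessel's inequality is small; on \<open>A\<close> both weights are
  close to 1. The budget is five shares of \<open>\<epsilon> / 5\<close>: one for the tail and two
  each for \<open>t m\<close> and \<open>t n\<close>.\<close>

lemma fejer_proj_Cauchy:
  assumes f: "square_integrable f" and "0 < \<epsilon>"
  shows "\<exists>N. \<forall>m\<ge>N. \<forall>n\<ge>N. (\<integral>z. (cmod (fejer_proj \<Gamma> m f z - fejer_proj \<Gamma> n f z))\<^sup>2 \<partial>torus) \<le> \<epsilon>"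
proof -
  define a where "a = (\<lambda>\<gamma>. (cmod (fourier f \<gamma>))\<^sup>2)"
  have a0: "0 \<le> a \<gamma>" for \<gamma>
    by (simp add: a_def)
  obtain A where A: "finite A" "\<And>X. finite X \<Longrightarrow> X \<inter> A = {} \<Longrightarrow> sum a X \<le> \<epsilon> / 5"
  proof (rule finite_sums_bounded_tail [of a "\<integral>z. (cmod (f z))\<^sup>2 \<partial>torus" "\<epsilon> / 5"])
    show "sum a X \<le> (\<integral>z. (cmod (f z))\<^sup>2 \<partial>torus)" if "finite X" for X
      unfolding a_def using that by (rule bessel_inequality [OF f])
  qed (use a0 \<open>0 < \<epsilon>\<close> in auto)
  define t where "t = (\<lambda>n. \<Sum>\<gamma>\<in>A. (fejer_coeff n \<gamma> - 1)\<^sup>2 * a \<gamma>)"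
  have "t \<longlonglongrightarrow> (\<Sum>\<gamma>\<in>A. (1 - 1)\<^sup>2 * a \<gamma>)"
    unfolding t_def by (intro tendsto_intros fejer_coeff_tendsto_1)
  then have "\<forall>\<^sub>F n in sequentially. t n < \<epsilon> / 5"
    using \<open>0 < \<epsilon>\<close> by (intro order_tendstoD) auto
  then obtain N where N: "\<And>n. N \<le> n \<Longrightarrow> t n < \<epsilon> / 5"
    by (auto simp: eventually_sequentially)
  have "(\<integral>z. (cmod (fejer_proj \<Gamma> m f z - fejer_proj \<Gamma> n f z))\<^sup>2 \<partial>torus) \<le> \<epsilon>" if mn: "N \<le> m" "N \<le> n" for m n
  proof -
    define E where "E = (box_diffs m \<union> box_diffs n) \<inter> \<Gamma>"
    have "finite E"
      by (simp add: E_def)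
    define w where "w = (\<lambda>\<gamma>. (fejer_coeff m \<gamma> - fejer_coeff n \<gamma>)\<^sup>2 * a \<gamma>)"
    have w0: "0 \<le> w \<gamma>" for \<gamma>
      by (simp add: w_def a0)
    have w_a: "w \<gamma> \<le> a \<gamma>" for \<gamma>
    proof -
      have "(fejer_coeff m \<gamma> - fejer_coeff n \<gamma>)\<^sup>2 \<le> 1"
        using fejer_coeff_nonneg [of m \<gamma>] fejer_coeff_nonneg [of n \<gamma>] fejer_coeff_le_1 [of m \<gamma>] fejer_coeff_le_1 [of n \<gamma>]
        by (simp add: abs_square_le_1)
      then show ?thesis
        unfolding w_def by (metis a0 mult_left_le_one_le zero_le_power2)
    qed
    have w_t: "w \<gamma> \<le> 2 * ((fejer_coeff m \<gamma> - 1)\<^sup>2 * a \<gamma>) + 2 * ((fejer_coeff n \<gamma> - 1)\<^sup>2 * a \<gamma>)" for \<gamma>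
    proof -
      have "(fejer_coeff m \<gamma> - fejer_coeff n \<gamma>)\<^sup>2 \<le> 2 * (fejer_coeff m \<gamma> - 1)\<^sup>2 + 2 * (fejer_coeff n \<gamma> - 1)\<^sup>2"
        using norm_add_squared_le [of "fejer_coeff m \<gamma> - 1" "1 - fejer_coeff n \<gamma>"] by (simp add: power2_commute)
      from mult_right_mono [OF this a0 [of \<gamma>]] show ?thesis
        by (simp add: w_def algebra_simps)
    qed
    have "(\<integral>z. (cmod (fejer_proj \<Gamma> m f z - fejer_proj \<Gamma> n f z))\<^sup>2 \<partial>torus) = (\<Sum>\<gamma>\<in>E. w \<gamma>)"
    proof -
      have "fejer_proj \<Gamma> m f z - fejer_proj \<Gamma> n f z
          = trig_poly E (\<lambda>\<gamma>. complex_of_real (fejer_coeff m \<gamma> - fejer_coeff n \<gamma>) * fourier f \<gamma>) z" for z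
        using fejer_proj_extend [of "box_diffs m \<union> box_diffs n" m \<Gamma> f] fejer_proj_extend [of "box_diffs m \<union> box_diffs n" n \<Gamma> f]
        by (simp add: trig_poly_diff E_def left_diff_distrib)
      then show ?thesis
        using integral_norm_trig_poly_squared [OF \<open>finite E\<close>]
        by (simp add: w_def a_def norm_mult power_mult_distrib flip: of_real_diff)
    qed
    also have "\<dots> = (\<Sum>\<gamma>\<in>E \<inter> A. w \<gamma>) + (\<Sum>\<gamma>\<in>E - A. w \<gamma>)"
      using \<open>finite E\<close> by (metis sum.Int_Diff)
    also have "(\<Sum>\<gamma>\<in>E - A. w \<gamma>) \<le> \<epsilon> / 5"
      using sum_mono [of "E - A" w a] w_a A(2) [of "E - A"] \<open>finite E\<close> by fastforce
    also have "(\<Sum>\<gamma>\<in>E \<inter> A. w \<gamma>) \<le> (\<Sum>\<gamma>\<in>A. w \<gamma>)"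
      using A w0 by (intro sum_mono2) auto
    also have "\<dots> \<le> (\<Sum>\<gamma>\<in>A. 2 * ((fejer_coeff m \<gamma> - 1)\<^sup>2 * a \<gamma>) + 2 * ((fejer_coeff n \<gamma> - 1)\<^sup>2 * a \<gamma>))"
      by (rule sum_mono) (rule w_t)
    also have "\<dots> = 2 * t m + 2 * t n"
      by (simp add: t_def sum.distrib sum_distrib_left)
    finally show ?thesis
      using N [OF mn(1)] N [OF mn(2)] by simp
  qed
  then show ?thesis by blast
qed

section \<open>Hardy spaces\<close>

text \<open>The orthogonal projection onto the frequencies in \<open>\<Gamma>\<close>, as a relation: \<open>g\<close> is only determined
  almost everywhere.\<close>

definition mean_square_proj :: "('d::finite \<Rightarrow> int) set \<Rightarrow> (('d \<Rightarrow> complex) \<Rightarrow> complex) \<Rightarrow> (('d \<Rightarrow> complex) \<Rightarrow> complex) \<Rightarrow> bool" where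
  "mean_square_proj \<Gamma> f g \<longleftrightarrow> g \<in> borel_measurable torus
    \<and> (\<forall>N. integrable torus (\<lambda>z. (cmod (g z - fejer_proj \<Gamma> N f z))\<^sup>2))
    \<and> (\<lambda>N. \<integral>z. (cmod (g z - fejer_proj \<Gamma> N f z))\<^sup>2 \<partial>torus) \<longlonglongrightarrow> 0"

lemma mean_square_proj_exists:
  assumes f: "square_integrable f"
  shows "\<exists>g. mean_square_proj \<Gamma> f g"
proof -
  have "integrable torus (\<lambda>z. (cmod (fejer_proj \<Gamma> m f z - fejer_proj \<Gamma> n f z))\<^sup>2)" for m n
    using square_integrable_diff [OF square_integrable_fejer_proj square_integrable_fejer_proj]
    by (simp add: square_integrable_def)
  then show ?thesis
    unfolding mean_square_proj_def
    by (rule torus.L2_complete [OF measurable_fejer_proj _ fejer_proj_Cauchy [OF f]]) blast+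
qed

lemma mean_square_proj_square_integrable:
  assumes "mean_square_proj \<Gamma> f g"
  shows "square_integrable g"
proof -
  have "square_integrable (\<lambda>z. g z - fejer_proj \<Gamma> 0 f z)"
    using assms by (auto simp: mean_square_proj_def square_integrable_def)
  from square_integrable_add [OF this square_integrable_fejer_proj [of \<Gamma> 0 f]] show ?thesis
    by simp
qed

lemma mean_square_proj_linear:
  assumes f: "square_integrable f" "square_integrable f'"
    and g: "mean_square_proj \<Gamma> f g" "mean_square_proj \<Gamma> f' g'"
  shows "mean_square_proj \<Gamma> (\<lambda>z. a * f z + b * f' z) (\<lambda>z. a * g z + b * g' z)"
proof -
  let ?e = "\<lambda>f g N z. g z - fejer_proj \<Gamma> N f z"
  let ?f = "\<lambda>z. a * f z + b * f' z" and ?g = "\<lambda>z. a * g z + b * g' z"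
  have [measurable]: "g \<in> borel_measurable torus" "g' \<in> borel_measurable torus"
    using g by (auto simp: mean_square_proj_def)
  have fourier: "fourier ?f \<gamma> = a * fourier f \<gamma> + b * fourier f' \<gamma>" for \<gamma>
    using f by (simp add: fourier_add fourier_scale square_integrable_imp_integrable)
  have split: "?e ?f ?g N z = a * ?e f g N z + b * ?e f' g' N z" for N z
    by (simp add: fejer_proj_def trig_poly_def fourier algebra_simps sum.distrib sum_distrib_left)
  have int: "integrable torus (\<lambda>z. (cmod (?e f g N z))\<^sup>2)" "integrable torus (\<lambda>z. (cmod (?e f' g' N z))\<^sup>2)" for N
    using g by (auto simp: mean_square_proj_def)
  define C where "C = (\<lambda>N z. 2 * (cmod a)\<^sup>2 * (cmod (?e f g N z))\<^sup>2 + 2 * (cmod b)\<^sup>2 * (cmod (?e f' g' N z))\<^sup>2)"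
  have C_int: "integrable torus (C N)" for N
    unfolding C_def using int by simp
  have le: "(cmod (?e ?f ?g N z))\<^sup>2 \<le> C N z" for N z
    unfolding split C_def using norm_add_squared_le [of "a * ?e f g N z" "b * ?e f' g' N z"]
    by (simp add: norm_mult power_mult_distrib mult.assoc)
  have int': "integrable torus (\<lambda>z. (cmod (?e ?f ?g N z))\<^sup>2)" for N
    using C_int [of N] by (rule Bochner_Integration.integrable_bound) (use le in \<open>auto intro!: AE_I2 order_trans [OF _ abs_ge_self]\<close>)
  have C_lim: "(\<lambda>N. \<integral>z. C N z \<partial>torus) \<longlonglongrightarrow> 0"
  proof -
    have "(\<lambda>N. 2 * (cmod a)\<^sup>2 * (\<integral>z. (cmod (?e f g N z))\<^sup>2 \<partial>torus) + 2 * (cmod b)\<^sup>2 * (\<integral>z. (cmod (?e f' g' N z))\<^sup>2 \<partial>torus))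
        \<longlonglongrightarrow> 2 * (cmod a)\<^sup>2 * 0 + 2 * (cmod b)\<^sup>2 * 0"
      using g unfolding mean_square_proj_def by (intro tendsto_intros) auto
    then show ?thesis
      unfolding C_def using int by simp
  qed
  have "(\<lambda>N. \<integral>z. (cmod (?e ?f ?g N z))\<^sup>2 \<partial>torus) \<longlonglongrightarrow> 0"
    by (rule tendsto_sandwich [OF _ _ tendsto_const C_lim])
       (auto intro!: always_eventually Bochner_Integration.integral_mono int' C_int le)
  with int' show ?thesis
    by (simp add: mean_square_proj_def)
qed

lemma mean_square_proj_unique:
  assumes g: "mean_square_proj \<Gamma> f g" "mean_square_proj \<Gamma> f g'"
  shows "AE z in torus. g z = g' z"
proof -
  let ?e = "\<lambda>g N z. g z - fejer_proj \<Gamma> N f z"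
  have [measurable]: "g \<in> borel_measurable torus" "g' \<in> borel_measurable torus"
    using g by (auto simp: mean_square_proj_def)
  have int: "integrable torus (\<lambda>z. (cmod (?e g N z))\<^sup>2)" "integrable torus (\<lambda>z. (cmod (?e g' N z))\<^sup>2)" for N
    using g by (auto simp: mean_square_proj_def)
  have d_int: "integrable torus (\<lambda>z. (cmod (g z - g' z))\<^sup>2)"
    using square_integrable_diff [OF g [THEN mean_square_proj_square_integrable]] by (simp add: square_integrable_def)
  have "(\<integral>z. (cmod (g z - g' z))\<^sup>2 \<partial>torus)
      \<le> 2 * (\<integral>z. (cmod (?e g N z))\<^sup>2 \<partial>torus) + 2 * (\<integral>z. (cmod (?e g' N z))\<^sup>2 \<partial>torus)" for N
  proof -
    have "(\<integral>z. (cmod (g z - g' z))\<^sup>2 \<partial>torus)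
        \<le> (\<integral>z. 2 * (cmod (?e g N z))\<^sup>2 + 2 * (cmod (?e g' N z))\<^sup>2 \<partial>torus)"
    proof (rule Bochner_Integration.integral_mono)
      fix z
      show "(cmod (g z - g' z))\<^sup>2 \<le> 2 * (cmod (?e g N z))\<^sup>2 + 2 * (cmod (?e g' N z))\<^sup>2"
        using norm_add_squared_le [of "?e g N z" "- ?e g' N z"] by (simp add: norm_minus_commute)
    qed (use d_int int in auto)
    then show ?thesis
      using int by simp
  qed
  moreover have "(\<lambda>N. 2 * (\<integral>z. (cmod (?e g N z))\<^sup>2 \<partial>torus) + 2 * (\<integral>z. (cmod (?e g' N z))\<^sup>2 \<partial>torus)) \<longlonglongrightarrow> 2 * 0 + 2 * 0"
    using g unfolding mean_square_proj_def by (intro tendsto_intros) auto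
  ultimately have "(\<integral>z. (cmod (g z - g' z))\<^sup>2 \<partial>torus) \<le> 0"
    by (intro LIMSEQ_le_const) auto
  then have "(\<integral>z. (cmod (g z - g' z))\<^sup>2 \<partial>torus) = 0"
    by (intro antisym) auto
  then have "AE z in torus. (cmod (g z - g' z))\<^sup>2 = 0"
    using integral_nonneg_eq_0_iff_AE [OF d_int] by simp
  then show ?thesis
    by eventually_elim simp
qed

text \<open>The error is a polynomial on the fixed finite set \<open>F \<inter> \<Gamma>\<close>
  whose coefficients carry the factor \<open>1 - fejer_coeff N \<gamma>\<close>, which tends to 0.
  With uniqueness this identifies the operator with \<open>proj\<close> on polynomials.\<close>

lemma mean_square_proj_trig_poly:
  assumes "finite F"
  shows "mean_square_proj \<Gamma> (trig_poly F c) (trig_poly (F \<inter> \<Gamma>) c)"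
proof -
  have "fejer_proj \<Gamma> N (trig_poly F c) = trig_poly (F \<inter> \<Gamma>) (\<lambda>\<gamma>. complex_of_real (fejer_coeff N \<gamma>) * c \<gamma>)" for N
  proof -
    have "fejer_proj \<Gamma> N (trig_poly F c)
        = trig_poly ((box_diffs N \<union> F) \<inter> \<Gamma>) (\<lambda>\<gamma>. complex_of_real (fejer_coeff N \<gamma>) * fourier (trig_poly F c) \<gamma>)"
      using assms by (intro fejer_proj_extend) auto
    also have "\<dots> = trig_poly (F \<inter> \<Gamma>) (\<lambda>\<gamma>. complex_of_real (fejer_coeff N \<gamma>) * fourier (trig_poly F c) \<gamma>)"
      using assms by (intro trig_poly_mono_neutral [symmetric]) (auto simp: fourier_trig_poly)
    also have "\<dots> = trig_poly (F \<inter> \<Gamma>) (\<lambda>\<gamma>. complex_of_real (fejer_coeff N \<gamma>) * c \<gamma>)"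
      unfolding trig_poly_def [of "F \<inter> \<Gamma>"] using assms by (intro ext sum.cong) (auto simp: fourier_trig_poly)
    finally show ?thesis .
  qed
  then have diff: "trig_poly (F \<inter> \<Gamma>) c z - fejer_proj \<Gamma> N (trig_poly F c) z
      = trig_poly (F \<inter> \<Gamma>) (\<lambda>\<gamma>. complex_of_real (1 - fejer_coeff N \<gamma>) * c \<gamma>) z" for N z
    by (simp add: trig_poly_diff left_diff_distrib)
  have "(\<lambda>N. \<Sum>\<gamma>\<in>F \<inter> \<Gamma>. (1 - fejer_coeff N \<gamma>)\<^sup>2 * (cmod (c \<gamma>))\<^sup>2) \<longlonglongrightarrow> (\<Sum>\<gamma>\<in>F \<inter> \<Gamma>. (1 - 1)\<^sup>2 * (cmod (c \<gamma>))\<^sup>2)"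
    by (intro tendsto_intros fejer_coeff_tendsto_1)
  then show ?thesis
    unfolding mean_square_proj_def diff using assms
    by (simp add: integrable_norm_trig_poly_power integral_norm_trig_poly_squared norm_mult power_mult_distrib
        del: of_real_diff)
qed

text \<open>Outside \<open>\<Gamma>\<close> the approximants have no Fourier coefficient, so that of
  \<open>g\<close> equals that of the error, and Bessel's inequality for one frequency bounds it by
  a null sequence.\<close>

lemma mean_square_proj_fourier:
  assumes g: "mean_square_proj \<Gamma> f g" and "\<alpha> \<notin> \<Gamma>"
  shows "fourier g \<alpha> = 0"
proof -
  have "(cmod (fourier g \<alpha>))\<^sup>2 \<le> (\<integral>z. (cmod (g z - fejer_proj \<Gamma> N f z))\<^sup>2 \<partial>torus)" for N
  proof -
    have "fourier (\<lambda>z. g z - fejer_proj \<Gamma> N f z) \<alpha> = fourier g \<alpha> - fourier (fejer_proj \<Gamma> N f) \<alpha>"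
      by (intro fourier_diff square_integrable_imp_integrable square_integrable_fejer_proj
          mean_square_proj_square_integrable [OF g])
    also have "fourier (fejer_proj \<Gamma> N f) \<alpha> = 0"
      using assms(2) unfolding fejer_proj_def by (simp add: fourier_trig_poly)
    finally show ?thesis
      using bessel_inequality [of "\<lambda>z. g z - fejer_proj \<Gamma> N f z" "{\<alpha>}"]
        square_integrable_diff [OF mean_square_proj_square_integrable [OF g] square_integrable_fejer_proj]
      by simp
  qed
  then have "(cmod (fourier g \<alpha>))\<^sup>2 \<le> 0"
    using g unfolding mean_square_proj_def by (intro LIMSEQ_le_const) auto
  then show ?thesis by simp
qed

lemma mean_square_proj_contractive:
  assumes f: "square_integrable f" "integrable torus (\<lambda>z. cmod (f z) ^ (2 * Suc n))"
    and analytic: "\<And>\<alpha>. \<alpha> \<notin> N0 \<Longrightarrow> fourier f \<alpha> = 0"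
    and "\<Gamma> \<subseteq> N0" and ext: "extension n \<Gamma> \<subseteq> \<Gamma>"
    and g: "mean_square_proj \<Gamma> f g"
  shows "integrable torus (\<lambda>z. cmod (g z) ^ (2 * Suc n))"
    and "(\<integral>z. cmod (g z) ^ (2 * Suc n) \<partial>torus) \<le> (\<integral>z. cmod (f z) ^ (2 * Suc n) \<partial>torus)"
proof -
  let ?p = "2 * Suc n"
  have [measurable]: "g \<in> borel_measurable torus" "f \<in> borel_measurable torus"
    using g f by (auto simp: mean_square_proj_def square_integrable_def)
  have bound: "(\<integral>z. cmod (fejer_proj \<Gamma> N f z) ^ ?p \<partial>torus) \<le> (\<integral>z. cmod (f z) ^ ?p \<partial>torus)" for N
  proof -
    let ?c = "\<lambda>\<gamma>. complex_of_real (fejer_coeff N \<gamma>) * fourier f \<gamma>"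
    have "(box_diffs N \<inter> N0) \<inter> \<Gamma> = box_diffs N \<inter> \<Gamma>"
      using \<open>\<Gamma> \<subseteq> N0\<close> by blast
    then have "(\<integral>z. cmod (fejer_proj \<Gamma> N f z) ^ ?p \<partial>torus)
        = (\<integral>z. cmod (trig_poly ((box_diffs N \<inter> N0) \<inter> \<Gamma>) ?c z) ^ ?p \<partial>torus)"
      by (simp only: fejer_proj_def)
    also have "\<dots> \<le> (\<integral>z. cmod (trig_poly (box_diffs N \<inter> N0) ?c z) ^ ?p \<partial>torus)"
      using ext by (intro trig_poly_projection_contractive) auto
    \<comment> \<open>Analyticity of \<open>f\<close> makes the coefficients outside
      \<open>N0\<close> vanish, so the analytic polynomial just bounded is the whole Fejer
      mean.\<close>
    also have "trig_poly (box_diffs N \<inter> N0) ?c = fejer_mean N f"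
      unfolding fejer_mean_def using analytic by (intro trig_poly_mono_neutral) auto
    also have "(\<integral>z. cmod (fejer_mean N f z) ^ ?p \<partial>torus) \<le> (\<integral>z. cmod (f z) ^ ?p \<partial>torus)"
      using fejer_mean_contractive [of f "Suc (2 * n)" N] f square_integrable_imp_integrable [OF f(1)] by simp
    finally show ?thesis .
  qed
  have int: "integrable torus (\<lambda>z. (cmod (g z - fejer_proj \<Gamma> N f z))\<^sup>2)" for N
    using g by (simp add: mean_square_proj_def)
  have "(\<lambda>N. \<integral>z. norm ((cmod (g z - fejer_proj \<Gamma> N f z))\<^sup>2) \<partial>torus) \<longlonglongrightarrow> 0"
    using g by (simp add: mean_square_proj_def)
  \<comment> \<open>Mean-square convergence gives a subsequence converging almost everywhere, as
    Fatou's lemma for the higher power requires.\<close>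
  from tendsto_L1_AE_subseq [OF int this]
  obtain r where r: "AE z in torus. (\<lambda>j. (cmod (g z - fejer_proj \<Gamma> (r j) f z))\<^sup>2) \<longlonglongrightarrow> 0"
    by blast
  have lim: "AE z in torus. (\<lambda>j. cmod (fejer_proj \<Gamma> (r j) f z) ^ ?p) \<longlonglongrightarrow> cmod (g z) ^ ?p"
    using r
  proof eventually_elim
    case (elim z)
    then have "(\<lambda>j. sqrt ((cmod (g z - fejer_proj \<Gamma> (r j) f z))\<^sup>2)) \<longlonglongrightarrow> sqrt 0"
      by (rule tendsto_real_sqrt)
    then have "(\<lambda>j. g z - fejer_proj \<Gamma> (r j) f z) \<longlonglongrightarrow> 0"
      by (simp add: tendsto_norm_zero_iff)
    from tendsto_diff [OF tendsto_const [of "g z"] this]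
    have "(\<lambda>j. fejer_proj \<Gamma> (r j) f z) \<longlonglongrightarrow> g z"
      by simp
    then show ?case
      by (intro tendsto_power tendsto_norm)
  qed
  have fp_int: "integrable torus (\<lambda>z. cmod (fejer_proj \<Gamma> N f z) ^ ?p)" for N
    unfolding fejer_proj_def by (rule integrable_norm_trig_poly_power)
  have C: "0 \<le> (\<integral>z. cmod (f z) ^ ?p \<partial>torus)"
    by simp
  note limit = integrable_limit_bounded [OF _ _ lim _ _ _ C]
  show "integrable torus (\<lambda>z. cmod (g z) ^ ?p)"
    by (rule limit) (auto simp: fp_int bound simp del: mult_Suc_right power_Suc intro: always_eventually)
  show "(\<integral>z. cmod (g z) ^ ?p \<partial>torus) \<le> (\<integral>z. cmod (f z) ^ ?p \<partial>torus)"
    by (rule limit) (auto simp: fp_int bound simp del: mult_Suc_right power_Suc intro: always_eventually)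
qed

section \<open>Hardy spaces of even exponent and the two implications\<close>

lemma norm_powr_even: "cmod w powr real (2 * (n + 1)) = cmod w ^ (2 * Suc n)"
proof (cases "w = 0")
  case False
  then show ?thesis
    unfolding Suc_eq_plus1 by (intro powr_realpow) simp
qed simp

lemma Lp_space_even:
  "f \<in> Lp_space (real (2 * (n + 1))) \<longleftrightarrow>
    f \<in> borel_measurable torus \<and> integrable torus (\<lambda>z. cmod (f z) ^ (2 * Suc n))"
  unfolding Lp_space_def norm_powr_even by simp

lemma Lp_norm_even_le_iff:
  "Lp_norm (real (2 * (n + 1))) f \<le> Lp_norm (real (2 * (n + 1))) g \<longleftrightarrow>
    (\<integral>z. cmod (f z) ^ (2 * Suc n) \<partial>torus) \<le> (\<integral>z. cmod (g z) ^ (2 * Suc n) \<partial>torus)"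
proof -
  have "x powr q \<le> y powr q \<longleftrightarrow> x \<le> y" if "0 \<le> x" "0 \<le> y" "0 < q" for x y q :: real
    using that powr_less_mono2 [of q y x] powr_mono2 [of q x y] by (auto simp: not_le [symmetric])
  then show ?thesis
    unfolding Lp_norm_def norm_powr_even by simp
qed

lemma Hardy_even:
  "f \<in> Hardy (real (2 * (n + 1))) \<longleftrightarrow>
    f \<in> borel_measurable torus \<and> integrable torus (\<lambda>z. cmod (f z) ^ (2 * Suc n)) \<and> (\<forall>\<alpha>. \<alpha> \<notin> N0 \<longrightarrow> fourier f \<alpha> = 0)"
  unfolding Hardy_def mem_Collect_eq Lp_space_even conj_assoc ..

text \<open>On a space of mass 1 the bound of a square by 1 plus the higher power suffices. This
  inclusion allows the mean-square projection to act on the whole Hardy space.\<close>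

lemma Hardy_square_integrable:
  assumes "f \<in> Hardy (real (2 * (n + 1)))"
  shows "square_integrable f"
proof -
  have [measurable]: "f \<in> borel_measurable torus" and int: "integrable torus (\<lambda>z. cmod (f z) ^ (2 * Suc n))"
    using assms unfolding Hardy_even by blast+
  have "integrable torus (\<lambda>z. 1 + cmod (f z) ^ (2 * Suc n))"
    using int by simp
  then have "integrable torus (\<lambda>z. (cmod (f z))\<^sup>2)"
  proof (rule Bochner_Integration.integrable_bound)
    have "x\<^sup>2 \<le> 1 + x ^ (2 * Suc n)" if "0 \<le> x" for x :: real
    proof (cases "x \<le> 1")
      case True
      then have "x\<^sup>2 \<le> 1"
        using that by (simp add: power_le_one)
      then show ?thesis
        using zero_le_power [OF that, of "2 * Suc n"] by linarith
    next
      case False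
      then have "x\<^sup>2 \<le> x ^ (2 * Suc n)"
        by (intro power_increasing) auto
      then show ?thesis by linarith
    qed
    then show "AE z in torus. norm ((cmod (f z))\<^sup>2) \<le> norm (1 + cmod (f z) ^ (2 * Suc n))"
      by (intro AE_I2) (simp del: mult_Suc_right power_Suc add: add_nonneg_nonneg abs_of_nonneg)
  qed measurable
  then show ?thesis
    by (simp add: square_integrable_def)
qed

lemma analytic_polys_eq: "analytic_polys = {trig_poly F c |F c. finite F \<and> F \<subseteq> N0}"
proof -
  have "trig_poly F c = (\<lambda>z. \<Sum>\<alpha>\<in>F. c \<alpha> * mono z \<alpha>)" for F :: "('a \<Rightarrow> int) set" and c
    by (rule ext) (rule trig_poly_def)
  then show ?thesis
    unfolding analytic_polys_def by auto
qed

lemma trig_poly_in_Hardy: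
  assumes "finite F" "F \<subseteq> N0"
  shows "trig_poly F c \<in> Hardy (real (2 * (n + 1)))"
  unfolding Hardy_even using assms
  by (auto intro: integrable_norm_trig_poly_power simp: fourier_trig_poly simp del: mult_Suc_right)

text \<open>The operator is tested on analytic polynomials, where it agrees almost everywhere with
  the projection; contractivity then becomes an inequality between integrals.\<close>

lemma contractive_projection_set_imp_extension:
  assumes contr: "contractive_projection_set (real (2 * (n + 1))) \<Gamma>" and "\<Gamma> \<subseteq> N0"
  shows "extension n \<Gamma> \<subseteq> \<Gamma>"
proof (rule trig_poly_projection_contractive_imp_extension [OF _ \<open>\<Gamma> \<subseteq> N0\<close>])
  let ?p = "real (2 * (n + 1))"
  fix F c assume F: "finite F" "F \<subseteq> (N0 :: ('a \<Rightarrow> int) set)"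
  obtain T where T: "\<And>f. f \<in> Hardy ?p \<Longrightarrow> T f \<in> Hardy ?p"
    "\<And>f. f \<in> Hardy ?p \<Longrightarrow> Lp_norm ?p (T f) \<le> Lp_norm ?p f"
    "\<And>f. f \<in> analytic_polys \<Longrightarrow> AE z in torus. T f z = proj \<Gamma> f z"
    using contr unfolding contractive_projection_set_def by blast
  let ?f = "trig_poly F c"
  have f: "?f \<in> Hardy ?p"
    using F by (rule trig_poly_in_Hardy)
  have f_poly: "?f \<in> analytic_polys"
    unfolding analytic_polys_eq using F by blast
  have [measurable]: "T ?f \<in> borel_measurable torus"
    using T(1) [OF f] unfolding Hardy_even by blast
  have "(\<integral>z. cmod (trig_poly (F \<inter> \<Gamma>) c z) ^ (2 * Suc n) \<partial>torus) = (\<integral>z. cmod (T ?f z) ^ (2 * Suc n) \<partial>torus)"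
  proof (rule integral_cong_AE)
    show "AE z in torus. cmod (trig_poly (F \<inter> \<Gamma>) c z) ^ (2 * Suc n) = cmod (T ?f z) ^ (2 * Suc n)"
      using T(3) [OF f_poly] unfolding proj_trig_poly [OF F(1)] by eventually_elim (simp only:)
  qed measurable
  also have "\<dots> \<le> (\<integral>z. cmod (?f z) ^ (2 * Suc n) \<partial>torus)"
    using T(2) [OF f] unfolding Lp_norm_even_le_iff .
  finally show "(\<integral>z. cmod (trig_poly (F \<inter> \<Gamma>) c z) ^ (2 * Suc n) \<partial>torus) \<le> (\<integral>z. cmod (?f z) ^ (2 * Suc n) \<partial>torus)" .
qed

lemma extension_imp_contractive_projection_set:
  assumes ext: "extension n \<Gamma> \<subseteq> \<Gamma>" and "\<Gamma> \<subseteq> N0"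
  shows "contractive_projection_set (real (2 * (n + 1))) \<Gamma>"
proof -
  let ?p = "real (2 * (n + 1))"
  \<comment> \<open>The candidates for \<open>g\<close> agree almost everywhere, so an arbitrary
    choice is linear up to null sets, which is the form of linearity that
    \<open>contractive_projection_set\<close> asks for.\<close>
  define T where "T = (\<lambda>f. SOME g. mean_square_proj \<Gamma> f g)"
  have T: "mean_square_proj \<Gamma> f (T f)" if "square_integrable f" for f
    unfolding T_def using mean_square_proj_exists [OF that] by (rule someI_ex)
  have bounded: "integrable torus (\<lambda>z. cmod (T f z) ^ (2 * Suc n))"
      "(\<integral>z. cmod (T f z) ^ (2 * Suc n) \<partial>torus) \<le> (\<integral>z. cmod (f z) ^ (2 * Suc n) \<partial>torus)"
    if f: "f \<in> Hardy ?p" for f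
  proof -
    have "integrable torus (\<lambda>z. cmod (f z) ^ (2 * Suc n))" "\<And>\<alpha>. \<alpha> \<notin> N0 \<Longrightarrow> fourier f \<alpha> = 0"
      using f unfolding Hardy_even by blast+
    note * = mean_square_proj_contractive [OF Hardy_square_integrable [OF f] this assms(2,1) T [OF Hardy_square_integrable [OF f]]]
    show "integrable torus (\<lambda>z. cmod (T f z) ^ (2 * Suc n))"
      by (rule *(1))
    show "(\<integral>z. cmod (T f z) ^ (2 * Suc n) \<partial>torus) \<le> (\<integral>z. cmod (f z) ^ (2 * Suc n) \<partial>torus)"
      by (rule *(2))
  qed
  show ?thesis
    unfolding contractive_projection_set_def
  proof (intro exI [of _ T] conjI ballI allI)
    fix f :: "('a \<Rightarrow> complex) \<Rightarrow> complex" assume f: "f \<in> Hardy ?p"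
    note Tf = T [OF Hardy_square_integrable [OF f]]
    have "T f \<in> borel_measurable torus"
      using Tf by (simp add: mean_square_proj_def)
    moreover have "fourier (T f) \<alpha> = 0" if "\<alpha> \<notin> N0" for \<alpha>
      using that \<open>\<Gamma> \<subseteq> N0\<close> by (intro mean_square_proj_fourier [OF Tf]) blast
    ultimately show "T f \<in> Hardy ?p"
      unfolding Hardy_even using bounded(1) [OF f] by blast
    show "Lp_norm ?p (T f) \<le> Lp_norm ?p f"
      unfolding Lp_norm_even_le_iff by (rule bounded(2) [OF f])
  next
    fix f g :: "('a \<Rightarrow> complex) \<Rightarrow> complex" and a b
    assume fg: "f \<in> Hardy ?p" "g \<in> Hardy ?p"
    have sq: "square_integrable f" "square_integrable g"
      by (rule Hardy_square_integrable, rule fg)+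
    then have "square_integrable (\<lambda>w. a * f w + b * g w)"
      by (intro square_integrable_add square_integrable_scale)
    then show "AE z in torus. T (\<lambda>w. a * f w + b * g w) z = a * T f z + b * T g z"
      by (rule mean_square_proj_unique [OF T mean_square_proj_linear [OF sq T [OF sq(1)] T [OF sq(2)]]])
  next
    fix f :: "('a \<Rightarrow> complex) \<Rightarrow> complex" assume "f \<in> analytic_polys"
    then obtain F c where F: "finite F" "f = trig_poly F c"
      by (auto simp: analytic_polys_eq)
    show "AE z in torus. T f z = proj \<Gamma> f z"
      unfolding F(2) proj_trig_poly [OF F(1)]
      by (rule mean_square_proj_unique [OF T [OF square_integrable_trig_poly] mean_square_proj_trig_poly [OF F(1)]])
  qed
qed

lemma subset_extension:
  assumes "\<Gamma> \<subseteq> N0"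
  shows "\<Gamma> \<subseteq> extension n \<Gamma>"
proof
  fix \<gamma> assume \<gamma>: "\<gamma> \<in> \<Gamma>"
  \<comment> \<open>The witness is \<open>\<gamma>\<close> written as \<open>n + 1\<close> copies of
    itself minus \<open>n\<close> copies.\<close>
  define b where "b = (\<lambda>i. int n * \<gamma> i)"
  have "b \<in> sumset n \<Gamma>"
    unfolding b_def using \<gamma> by (rule multiple_in_sumset)
  moreover from \<gamma> this have "\<gamma> + b \<in> sumset (Suc n) \<Gamma>"
    by (rule sumset_SucI)
  moreover have "\<gamma> = (\<gamma> + b) - b"
    by simp
  ultimately show "\<gamma> \<in> extension n \<Gamma>"
    unfolding extension_eq_sumset using \<gamma> assms by blast
qed

theorem theorem1p3:
  fixes \<Gamma> :: "('d::finite \<Rightarrow> int) set" and n :: nat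
  assumes "\<Gamma> \<noteq> {}" and "\<Gamma> \<subseteq> N0"
  shows "contractive_projection_set (real (2 * (n + 1))) \<Gamma> \<longleftrightarrow> extension n \<Gamma> = \<Gamma>"
proof
  assume "contractive_projection_set (real (2 * (n + 1))) \<Gamma>"
  then show "extension n \<Gamma> = \<Gamma>"
    using assms(2) by (intro antisym contractive_projection_set_imp_extension subset_extension)
next
  assume "extension n \<Gamma> = \<Gamma>"
  then show "contractive_projection_set (real (2 * (n + 1))) \<Gamma>"
    using assms(2) by (intro extension_imp_contractive_projection_set) auto
qed

end
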